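(* The category $\mathsf{XAWB}$ of crossed modules of algebras with bracket and the category $\mathsf{IAWB}$ of internal categories in the category $\mathsf{AWB}$ of algebras with bracket are equivalent.
   Context: Fix a field $\mathbb K$; all vector spaces, algebras and linear maps are over $\mathbb K$. An algebra with bracket (AWB) is an associative (not necessarily commutative or unital) algebra $A$ with a bilinear map $[-,-]\colon A\times A\to A$ such that $[ab,c]=[a,c]b+a[b,c]$ for all $a,b,c\in A$. Homomorphisms preserve product and bracket; $\mathsf{AWB}$ is the resulting category. An action of an AWB $A$ on an AWB $M$ consists of four bilinear maps $A\times M\to M$, $(a,m)\mapsto a\cdot m$ and $(a,m)\mapsto\{a,m\}$, and $M\times A\to M$, $(m,a)\mapsto m\cdot a$ and $(m,a)\mapsto\{m,a\}$, such that for all $a,a_1,a_2\in A$, $m,m_1,m_2\in M$: $(a_1a_2)\cdot m=a_1\cdot(a_2\cdot m)$, $m\cdot(a_1a_2)=(m\cdot a_1)\cdot a_2$, $(a_1\cdot m)\cdot a_2=a_1\cdot(m\cdot a_2)$, $(m_1m_2)\cdot a=m_1(m_2\cdot a)$, $a\cdot(m_1m_2)=(a\cdot m_1)m_2$, $(m_1\cdot a)m_2=m_1(a\cdot m_2)$, $\{a_1\cdot m,a_2\}=a_1\cdot\{m,a_2\}+[a_1,a_2]\cdot m$, $\{m\cdot a_1,a_2\}=\{m,a_2\}\cdot a_1+m\cdot[a_1,a_2]$, $\{a_1a_2,m\}=a_1\cdot\{a_2,m\}+\{a_1,m\}\cdot a_2$, $[m_1\cdot a,m_2]=m_1\{a,m_2\}+[m_1,m_2]\cdot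 a$, $[a\cdot m_1,m_2]=a\cdot[m_1,m_2]+\{a,m_2\}m_1$, $\{m_1m_2,a\}=m_1\{m_2,a\}+\{m_1,a\}m_2$. A crossed module of AWBs is a homomorphism $\mu\colon M\to A$ of AWBs together with an action of $A$ on $M$ such that for all $m,m'\in M$, $a\in A$: (CM1) $\mu(m\cdot a)=\mu(m)a$, $\mu(a\cdot m)=a\mu(m)$, $\mu\{m,a\}=[\mu(m),a]$, $\mu\{a,m\}=[a,\mu(m)]$; (CM2) $\mu(m)\cdot m'=mm'=m\cdot\mu(m')$, $\{\mu(m),m'\}=[m,m']=\{m,\mu(m')\}$. A morphism from $\mu\colon M\to A$ to $\mu'\colon M'\to A'$ is a pair of AWB homomorphisms $\alpha\colon M\to M'$, $\beta\colon A\to A'$ with $\beta\mu=\mu'\alpha$ and $\alpha(a\cdot m)=\beta(a)\cdot\alpha(m)$, $\alpha(m\cdot a)=\alpha(m)\cdot\beta(a)$, $\alpha\{a,m\}=\{\beta(a),\alpha(m)\}$, $\alpha\{m,a\}=\{\alpha(m),\beta(a)\}$. These form the category $\mathsf{XAWB}$. An internal category in $\mathsf{AWB}$ is a tuple $(B,A,s,t,\sigma,\gamma)$ of AWBs $B,A$ and AWB homomorphisms $s,t\colon B\to A$, $\sigma\colon A\to B$, $\gamma\colon B\times_AB\to B$, where $B\times_AB=\{(b_1,b_2)\in B\times B\mid t(b_1)=s(b_2)\}$, such that $s\sigma=t\sigma=\mathrm{id}_A$ and $\gamma$ satisfies the usual axioms of a category: $s\gamma(b_1,b_2)=s(b_1)$,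 $t\gamma(b_1,b_2)=t(b_2)$, $\gamma(\sigma s(b),b)=b=\gamma(b,\sigma t(b))$, and $\gamma(\gamma(b_1,b_2),b_3)=\gamma(b_1,\gamma(b_2,b_3))$ whenever defined. A morphism $(B,A,s,t,\sigma,\gamma)\to(B',A',s',t',\sigma',\gamma')$ is a pair of AWB homomorphisms $\varphi\colon B\to B'$, $\psi\colon A\to A'$ with $\psi s=s'\varphi$, $\psi t=t'\varphi$, $\varphi\sigma=\sigma'\psi$, $\varphi\gamma=\gamma'(\varphi\times\varphi)$. These form the category $\mathsf{IAWB}$. *)

theory Defs
  imports "HOL-Algebra.Module"
begin

section \<open>Categories and their equivalence\<close>

text \<open>
  Categories are given by hom-sets indexed by pairs of objects; hom-sets of different pairs need not
  be disjoint, so composition, and the action of a functor on arrows, take the objects as arguments.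
  \<open>Comp C X Y Z g f\<close> is the composite of \<open>f \<in> Hom C X Y\<close> followed by \<open>g \<in> Hom C Y Z\<close>.
\<close>

record ('o, 'm) cat =
  Obj :: "'o set"
  Hom :: "'o \<Rightarrow> 'o \<Rightarrow> 'm set"
  Id :: "'o \<Rightarrow> 'm"
  Comp :: "'o \<Rightarrow> 'o \<Rightarrow> 'o \<Rightarrow> 'm \<Rightarrow> 'm \<Rightarrow> 'm"

locale category =
  fixes C :: "('o, 'm) cat"
  assumes Id_in_Hom: "X \<in> Obj C \<Longrightarrow> Id C X \<in> Hom C X X"
    and Comp_in_Hom: "\<lbrakk>X \<in> Obj C; Y \<in> Obj C; Z \<in> Obj C; f \<in> Hom C X Y; g \<in> Hom C Y Z\<rbrakk>
      \<Longrightarrow> Comp C X Y Z g f \<in> Hom C X Z"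
    and Comp_Id_right: "\<lbrakk>X \<in> Obj C; Y \<in> Obj C; f \<in> Hom C X Y\<rbrakk> \<Longrightarrow> Comp C X X Y f (Id C X) = f"
    and Comp_Id_left: "\<lbrakk>X \<in> Obj C; Y \<in> Obj C; f \<in> Hom C X Y\<rbrakk> \<Longrightarrow> Comp C X Y Y (Id C Y) f = f"
    and Comp_assoc: "\<lbrakk>W \<in> Obj C; X \<in> Obj C; Y \<in> Obj C; Z \<in> Obj C;
        f \<in> Hom C W X; g \<in> Hom C X Y; h \<in> Hom C Y Z\<rbrakk>
      \<Longrightarrow> Comp C W Y Z h (Comp C W X Y g f) = Comp C W X Z (Comp C X Y Z h g) f"

definition cat_iso :: "('o, 'm) cat \<Rightarrow> 'o \<Rightarrow> 'o \<Rightarrow> 'm \<Rightarrow> bool" where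
  "cat_iso C X Y f \<longleftrightarrow> f \<in> Hom C X Y \<and>
     (\<exists>g \<in> Hom C Y X. Comp C X Y X g f = Id C X \<and> Comp C Y X Y f g = Id C Y)"

locale cat_functor = C: category C + D: category D
  for C :: "('o, 'm) cat" and D :: "('p, 'n) cat" +
  fixes Fo :: "'o \<Rightarrow> 'p"
    and Fa :: "'o \<Rightarrow> 'o \<Rightarrow> 'm \<Rightarrow> 'n"
  assumes Fo_Obj: "X \<in> Obj C \<Longrightarrow> Fo X \<in> Obj D"
    and Fa_Hom: "\<lbrakk>X \<in> Obj C; Y \<in> Obj C; f \<in> Hom C X Y\<rbrakk> \<Longrightarrow> Fa X Y f \<in> Hom D (Fo X) (Fo Y)"
    and Fa_Id: "X \<in> Obj C \<Longrightarrow> Fa X X (Id C X) = Id D (Fo X)"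
    and Fa_Comp: "\<lbrakk>X \<in> Obj C; Y \<in> Obj C; Z \<in> Obj C; f \<in> Hom C X Y; g \<in> Hom C Y Z\<rbrakk>
      \<Longrightarrow> Fa X Z (Comp C X Y Z g f) = Comp D (Fo X) (Fo Y) (Fo Z) (Fa Y Z g) (Fa X Y f)"

locale natural_iso = F: cat_functor C D Fo Fa + G: cat_functor C D Go Ga
  for C :: "('o, 'm) cat" and D :: "('p, 'n) cat" and Fo Fa Go Ga +
  fixes \<eta> :: "'o \<Rightarrow> 'n"
  assumes component_iso: "X \<in> Obj C \<Longrightarrow> cat_iso D (Fo X) (Go X) (\<eta> X)"
    and naturality: "\<lbrakk>X \<in> Obj C; Y \<in> Obj C; f \<in> Hom C X Y\<rbrakk>
      \<Longrightarrow> Comp D (Fo X) (Fo Y) (Go Y) (\<eta> Y) (Fa X Y f)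
        = Comp D (Fo X) (Go X) (Go Y) (Ga X Y f) (\<eta> X)"

definition equivalent_categories :: "('o, 'm) cat \<Rightarrow> ('p, 'n) cat \<Rightarrow> bool" where
  "equivalent_categories C D \<longleftrightarrow> category C \<and> category D \<and>
     (\<exists>Fo Fa Go Ga \<eta> \<epsilon>.
        cat_functor C D Fo Fa \<and> cat_functor D C Go Ga \<and>
        natural_iso C C (\<lambda>X. X) (\<lambda>X Y f. f)
          (\<lambda>X. Go (Fo X)) (\<lambda>X Y f. Ga (Fo X) (Fo Y) (Fa X Y f)) \<eta> \<and>
        natural_iso D D (\<lambda>X. Fo (Go X)) (\<lambda>X Y f. Fa (Go X) (Go Y) (Ga X Y f))
          (\<lambda>X. X) (\<lambda>X Y f. f) \<epsilon>)"


section \<open>Algebras with bracket\<close>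

definition linear_map ::
    "('k, 'r) ring_scheme \<Rightarrow> ('k, 'v, 'x) module_scheme \<Rightarrow> ('k, 'w, 'y) module_scheme
      \<Rightarrow> ('v \<Rightarrow> 'w) \<Rightarrow> bool" where
  "linear_map K V W f \<longleftrightarrow> f \<in> carrier V \<rightarrow> carrier W \<and>
     (\<forall>x \<in> carrier V. \<forall>y \<in> carrier V. f (x \<oplus>\<^bsub>V\<^esub> y) = f x \<oplus>\<^bsub>W\<^esub> f y) \<and>
     (\<forall>c \<in> carrier K. \<forall>x \<in> carrier V. f (c \<odot>\<^bsub>V\<^esub> x) = c \<odot>\<^bsub>W\<^esub> f x)"

definition bilinear_map ::
    "('k, 'r) ring_scheme \<Rightarrow> ('k, 'u, 'x) module_scheme \<Rightarrow> ('k, 'v, 'y) module_scheme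
      \<Rightarrow> ('k, 'w, 'z) module_scheme \<Rightarrow> ('u \<Rightarrow> 'v \<Rightarrow> 'w) \<Rightarrow> bool" where
  "bilinear_map K U V W f \<longleftrightarrow>
     (\<forall>x \<in> carrier U. linear_map K V W (f x)) \<and>
     (\<forall>y \<in> carrier V. linear_map K U W (\<lambda>x. f x y))"

text \<open>
  The underlying vector space is a module over the field \<open>K\<close>, and the algebra product is the field
  \<open>mult\<close> of the ring record.  Algebras are not assumed unital: the record field \<open>one\<close> carries no
  meaning: no axiom and no homomorphism condition mentions it.  As usual with records, the values of
  the operations outside the carriers are unconstrained; objects differing only there, or in
  \<open>one\<close>, are isomorphic by identity maps.
\<close>

record ('k, 'a) awb = "('k, 'a) module" +
  bracket :: "'a \<Rightarrow> 'a \<Rightarrow> 'a"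

locale algebra_with_bracket = K: field K + module K A
  for K :: "('k, 'r) ring_scheme" and A :: "('k, 'a) awb" +
  assumes mult_bilinear: "bilinear_map K A A A (mult A)"
    and mult_assoc: "\<lbrakk>a \<in> carrier A; b \<in> carrier A; c \<in> carrier A\<rbrakk>
      \<Longrightarrow> (a \<otimes>\<^bsub>A\<^esub> b) \<otimes>\<^bsub>A\<^esub> c = a \<otimes>\<^bsub>A\<^esub> (b \<otimes>\<^bsub>A\<^esub> c)"
    and bracket_bilinear: "bilinear_map K A A A (bracket A)"
    and bracket_mult: "\<lbrakk>a \<in> carrier A; b \<in> carrier A; c \<in> carrier A\<rbrakk>
      \<Longrightarrow> bracket A (a \<otimes>\<^bsub>A\<^esub> b) c = bracket A a c \<otimes>\<^bsub>A\<^esub> b \<oplus>\<^bsub>A\<^esub> a \<otimes>\<^bsub>A\<^esub> bracket A b c"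

text \<open>Homomorphisms are extensional, so that two of them are equal iff they agree on the carrier.\<close>

definition awb_hom ::
    "('k, 'r) ring_scheme \<Rightarrow> ('k, 'a) awb \<Rightarrow> ('k, 'b) awb \<Rightarrow> ('a \<Rightarrow> 'b) set" where
  "awb_hom K A B = {f \<in> extensional (carrier A). linear_map K A B f \<and>
     (\<forall>x \<in> carrier A. \<forall>y \<in> carrier A. f (x \<otimes>\<^bsub>A\<^esub> y) = f x \<otimes>\<^bsub>B\<^esub> f y) \<and>
     (\<forall>x \<in> carrier A. \<forall>y \<in> carrier A. f (bracket A x y) = bracket B (f x) (f y))}"


section \<open>Crossed modules\<close>

text \<open>
  The four maps of an action: \<open>lact\<close> is \<open>a \<cdot> m\<close>, \<open>ract\<close> is \<open>m \<cdot> a\<close>, \<open>lbr\<close> is \<open>{a, m}\<close> and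
  \<open>rbr\<close> is \<open>{m, a}\<close>.
\<close>

record ('a, 'm) awb_act =
  lact :: "'a \<Rightarrow> 'm \<Rightarrow> 'm"
  ract :: "'m \<Rightarrow> 'a \<Rightarrow> 'm"
  lbr :: "'a \<Rightarrow> 'm \<Rightarrow> 'm"
  rbr :: "'m \<Rightarrow> 'a \<Rightarrow> 'm"

locale awb_action = A: algebra_with_bracket K A + M: algebra_with_bracket K M
  for K :: "('k, 'r) ring_scheme" and A :: "('k, 'a) awb" and M :: "('k, 'm) awb" +
  fixes act :: "('a, 'm) awb_act"
  assumes lact_bilinear: "bilinear_map K A M M (lact act)"
    and ract_bilinear: "bilinear_map K M A M (ract act)"
    and lbr_bilinear: "bilinear_map K A M M (lbr act)"
    and rbr_bilinear: "bilinear_map K M A M (rbr act)"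
    and lact_mult: "\<lbrakk>a1 \<in> carrier A; a2 \<in> carrier A; m \<in> carrier M\<rbrakk>
      \<Longrightarrow> lact act (a1 \<otimes>\<^bsub>A\<^esub> a2) m = lact act a1 (lact act a2 m)"
    and ract_mult: "\<lbrakk>a1 \<in> carrier A; a2 \<in> carrier A; m \<in> carrier M\<rbrakk>
      \<Longrightarrow> ract act m (a1 \<otimes>\<^bsub>A\<^esub> a2) = ract act (ract act m a1) a2"
    and lact_ract: "\<lbrakk>a1 \<in> carrier A; a2 \<in> carrier A; m \<in> carrier M\<rbrakk>
      \<Longrightarrow> ract act (lact act a1 m) a2 = lact act a1 (ract act m a2)"
    and mult_ract: "\<lbrakk>a \<in> carrier A; m1 \<in> carrier M; m2 \<in> carrier M\<rbrakk>
      \<Longrightarrow> ract act (m1 \<otimes>\<^bsub>M\<^esub> m2) a = m1 \<otimes>\<^bsub>M\<^esub> ract act m2 a"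
    and mult_lact: "\<lbrakk>a \<in> carrier A; m1 \<in> carrier M; m2 \<in> carrier M\<rbrakk>
      \<Longrightarrow> lact act a (m1 \<otimes>\<^bsub>M\<^esub> m2) = lact act a m1 \<otimes>\<^bsub>M\<^esub> m2"
    and ract_mult_lact: "\<lbrakk>a \<in> carrier A; m1 \<in> carrier M; m2 \<in> carrier M\<rbrakk>
      \<Longrightarrow> ract act m1 a \<otimes>\<^bsub>M\<^esub> m2 = m1 \<otimes>\<^bsub>M\<^esub> lact act a m2"
    and rbr_lact: "\<lbrakk>a1 \<in> carrier A; a2 \<in> carrier A; m \<in> carrier M\<rbrakk>
      \<Longrightarrow> rbr act (lact act a1 m) a2 = lact act a1 (rbr act m a2) \<oplus>\<^bsub>M\<^esub> lact act (bracket A a1 a2) m"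
    and rbr_ract: "\<lbrakk>a1 \<in> carrier A; a2 \<in> carrier A; m \<in> carrier M\<rbrakk>
      \<Longrightarrow> rbr act (ract act m a1) a2 = ract act (rbr act m a2) a1 \<oplus>\<^bsub>M\<^esub> ract act m (bracket A a1 a2)"
    and lbr_mult: "\<lbrakk>a1 \<in> carrier A; a2 \<in> carrier A; m \<in> carrier M\<rbrakk>
      \<Longrightarrow> lbr act (a1 \<otimes>\<^bsub>A\<^esub> a2) m = lact act a1 (lbr act a2 m) \<oplus>\<^bsub>M\<^esub> ract act (lbr act a1 m) a2"
    and bracket_ract: "\<lbrakk>a \<in> carrier A; m1 \<in> carrier M; m2 \<in> carrier M\<rbrakk>
      \<Longrightarrow> bracket M (ract act m1 a) m2 = m1 \<otimes>\<^bsub>M\<^esub> lbr act a m2 \<oplus>\<^bsub>M\<^esub> ract act (bracket M m1 m2) a"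
    and bracket_lact: "\<lbrakk>a \<in> carrier A; m1 \<in> carrier M; m2 \<in> carrier M\<rbrakk>
      \<Longrightarrow> bracket M (lact act a m1) m2 = lact act a (bracket M m1 m2) \<oplus>\<^bsub>M\<^esub> lbr act a m2 \<otimes>\<^bsub>M\<^esub> m1"
    and rbr_mult: "\<lbrakk>a \<in> carrier A; m1 \<in> carrier M; m2 \<in> carrier M\<rbrakk>
      \<Longrightarrow> rbr act (m1 \<otimes>\<^bsub>M\<^esub> m2) a = m1 \<otimes>\<^bsub>M\<^esub> rbr act m2 a \<oplus>\<^bsub>M\<^esub> rbr act m1 a \<otimes>\<^bsub>M\<^esub> m2"

text \<open>A crossed module \<open>bdry X : upper X \<rightarrow> base X\<close>, where \<open>base X\<close> acts on \<open>upper X\<close> by \<open>action X\<close>.\<close>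

record ('k, 'u) xmod =
  upper :: "('k, 'u) awb"
  base :: "('k, 'u) awb"
  bdry :: "'u \<Rightarrow> 'u"
  action :: "('u, 'u) awb_act"

locale crossed_module =
  awb_action K "base X" "upper X" "action X"
  for K :: "('k, 'r) ring_scheme" and X :: "('k, 'u) xmod" +
  assumes bdry_hom: "bdry X \<in> awb_hom K (upper X) (base X)"
    and CM1: "\<lbrakk>a \<in> carrier (base X); m \<in> carrier (upper X)\<rbrakk>
        \<Longrightarrow> bdry X (ract (action X) m a) = bdry X m \<otimes>\<^bsub>base X\<^esub> a"
      "\<lbrakk>a \<in> carrier (base X); m \<in> carrier (upper X)\<rbrakk>
        \<Longrightarrow> bdry X (lact (action X) a m) = a \<otimes>\<^bsub>base X\<^esub> bdry X m"
      "\<lbrakk>a \<in> carrier (base X); m \<in> carrier (upper X)\<rbrakk>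
        \<Longrightarrow> bdry X (rbr (action X) m a) = bracket (base X) (bdry X m) a"
      "\<lbrakk>a \<in> carrier (base X); m \<in> carrier (upper X)\<rbrakk>
        \<Longrightarrow> bdry X (lbr (action X) a m) = bracket (base X) a (bdry X m)"
    and CM2: "\<lbrakk>m \<in> carrier (upper X); m' \<in> carrier (upper X)\<rbrakk>
        \<Longrightarrow> lact (action X) (bdry X m) m' = m \<otimes>\<^bsub>upper X\<^esub> m'"
      "\<lbrakk>m \<in> carrier (upper X); m' \<in> carrier (upper X)\<rbrakk>
        \<Longrightarrow> ract (action X) m (bdry X m') = m \<otimes>\<^bsub>upper X\<^esub> m'"
      "\<lbrakk>m \<in> carrier (upper X); m' \<in> carrier (upper X)\<rbrakk>
        \<Longrightarrow> lbr (action X) (bdry X m) m' = bracket (upper X) m m'"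
      "\<lbrakk>m \<in> carrier (upper X); m' \<in> carrier (upper X)\<rbrakk>
        \<Longrightarrow> rbr (action X) m (bdry X m') = bracket (upper X) m m'"

definition xmod_hom ::
    "('k, 'r) ring_scheme \<Rightarrow> ('k, 'u) xmod \<Rightarrow> ('k, 'u) xmod \<Rightarrow> (('u \<Rightarrow> 'u) \<times> ('u \<Rightarrow> 'u)) set" where
  "xmod_hom K X Y = {(\<alpha>, \<beta>).
     \<alpha> \<in> awb_hom K (upper X) (upper Y) \<and> \<beta> \<in> awb_hom K (base X) (base Y) \<and>
     (\<forall>m \<in> carrier (upper X). \<beta> (bdry X m) = bdry Y (\<alpha> m)) \<and>
     (\<forall>a \<in> carrier (base X). \<forall>m \<in> carrier (upper X).
        \<alpha> (lact (action X) a m) = lact (action Y) (\<beta> a) (\<alpha> m) \<and>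
        \<alpha> (ract (action X) m a) = ract (action Y) (\<alpha> m) (\<beta> a) \<and>
        \<alpha> (lbr (action X) a m) = lbr (action Y) (\<beta> a) (\<alpha> m) \<and>
        \<alpha> (rbr (action X) m a) = rbr (action Y) (\<alpha> m) (\<beta> a))}"

text \<open>
  The type \<open>'u\<close> is the universe of underlying elements: the objects are the crossed modules whose
  two algebras have arbitrary subsets of \<open>'u\<close> as carriers.  For an infinite \<open>'u\<close> such carriers are
  closed, up to bijection, under binary products.
\<close>

definition XAWB ::
    "('k, 'r) ring_scheme \<Rightarrow> (('k, 'u) xmod, ('u \<Rightarrow> 'u) \<times> ('u \<Rightarrow> 'u)) cat" where
  "XAWB K = \<lparr>
     Obj = {X. crossed_module K X},
     Hom = xmod_hom K,
     Id = (\<lambda>X. (\<lambda>m \<in> carrier (upper X). m, \<lambda>a \<in> carrier (base X). a)),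
     Comp = (\<lambda>X Y Z (\<alpha>', \<beta>') (\<alpha>, \<beta>).
       (compose (carrier (upper X)) \<alpha>' \<alpha>, compose (carrier (base X)) \<beta>' \<beta>))\<rparr>"


section \<open>Internal categories in algebras with bracket\<close>

definition awb_pullback ::
    "('k, 'b) awb \<Rightarrow> ('b \<Rightarrow> 'a) \<Rightarrow> ('b \<Rightarrow> 'a) \<Rightarrow> ('k, 'b \<times> 'b) awb" where
  "awb_pullback B t s = \<lparr>
     carrier = {(x, y). x \<in> carrier B \<and> y \<in> carrier B \<and> t x = s y},
     mult = (\<lambda>(x, y) (x', y'). (x \<otimes>\<^bsub>B\<^esub> x', y \<otimes>\<^bsub>B\<^esub> y')),
     one = (\<one>\<^bsub>B\<^esub>, \<one>\<^bsub>B\<^esub>),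
     zero = (\<zero>\<^bsub>B\<^esub>, \<zero>\<^bsub>B\<^esub>),
     add = (\<lambda>(x, y) (x', y'). (x \<oplus>\<^bsub>B\<^esub> x', y \<oplus>\<^bsub>B\<^esub> y')),
     smult = (\<lambda>c (x, y). (c \<odot>\<^bsub>B\<^esub> x, c \<odot>\<^bsub>B\<^esub> y)),
     bracket = (\<lambda>(x, y) (x', y'). (bracket B x x', bracket B y y'))\<rparr>"

text \<open>
  In the tuple \<open>(B, A, s, t, \<sigma>, \<gamma>)\<close>, \<open>B\<close> is \<open>arr I\<close>, \<open>A\<close> is \<open>obj I\<close>, \<open>s\<close> is \<open>src I\<close>, \<open>t\<close> is \<open>trg I\<close>,
  \<open>\<sigma>\<close> is \<open>idn I\<close> and \<open>\<gamma>\<close> is \<open>cmp I\<close>.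
\<close>

record ('k, 'u) icat =
  arr :: "('k, 'u) awb"
  obj :: "('k, 'u) awb"
  src :: "'u \<Rightarrow> 'u"
  trg :: "'u \<Rightarrow> 'u"
  idn :: "'u \<Rightarrow> 'u"
  cmp :: "'u \<times> 'u \<Rightarrow> 'u"

locale internal_category =
  B: algebra_with_bracket K "arr I" + A: algebra_with_bracket K "obj I"
  for K :: "('k, 'r) ring_scheme" and I :: "('k, 'u) icat" +
  assumes src_hom: "src I \<in> awb_hom K (arr I) (obj I)"
    and trg_hom: "trg I \<in> awb_hom K (arr I) (obj I)"
    and idn_hom: "idn I \<in> awb_hom K (obj I) (arr I)"
    and cmp_hom: "cmp I \<in> awb_hom K (awb_pullback (arr I) (trg I) (src I)) (arr I)"
    and src_idn: "a \<in> carrier (obj I) \<Longrightarrow> src I (idn I a) = a"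
    and trg_idn: "a \<in> carrier (obj I) \<Longrightarrow> trg I (idn I a) = a"
    and src_cmp: "\<lbrakk>b1 \<in> carrier (arr I); b2 \<in> carrier (arr I); trg I b1 = src I b2\<rbrakk>
      \<Longrightarrow> src I (cmp I (b1, b2)) = src I b1"
    and trg_cmp: "\<lbrakk>b1 \<in> carrier (arr I); b2 \<in> carrier (arr I); trg I b1 = src I b2\<rbrakk>
      \<Longrightarrow> trg I (cmp I (b1, b2)) = trg I b2"
    and cmp_idn_left: "b \<in> carrier (arr I) \<Longrightarrow> cmp I (idn I (src I b), b) = b"
    and cmp_idn_right: "b \<in> carrier (arr I) \<Longrightarrow> cmp I (b, idn I (trg I b)) = b"
    and cmp_assoc: "\<lbrakk>b1 \<in> carrier (arr I); b2 \<in> carrier (arr I); b3 \<in> carrier (arr I);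
        trg I b1 = src I b2; trg I b2 = src I b3\<rbrakk>
      \<Longrightarrow> cmp I (cmp I (b1, b2), b3) = cmp I (b1, cmp I (b2, b3))"

definition icat_hom ::
    "('k, 'r) ring_scheme \<Rightarrow> ('k, 'u) icat \<Rightarrow> ('k, 'u) icat \<Rightarrow> (('u \<Rightarrow> 'u) \<times> ('u \<Rightarrow> 'u)) set" where
  "icat_hom K I J = {(\<phi>, \<psi>).
     \<phi> \<in> awb_hom K (arr I) (arr J) \<and> \<psi> \<in> awb_hom K (obj I) (obj J) \<and>
     (\<forall>b \<in> carrier (arr I). \<psi> (src I b) = src J (\<phi> b)) \<and>
     (\<forall>b \<in> carrier (arr I). \<psi> (trg I b) = trg J (\<phi> b)) \<and>
     (\<forall>a \<in> carrier (obj I). \<phi> (idn I a) = idn J (\<psi> a)) \<and>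
     (\<forall>b1 \<in> carrier (arr I). \<forall>b2 \<in> carrier (arr I). trg I b1 = src I b2 \<longrightarrow>
        \<phi> (cmp I (b1, b2)) = cmp J (\<phi> b1, \<phi> b2))}"

definition IAWB ::
    "('k, 'r) ring_scheme \<Rightarrow> (('k, 'u) icat, ('u \<Rightarrow> 'u) \<times> ('u \<Rightarrow> 'u)) cat" where
  "IAWB K = \<lparr>
     Obj = {I. internal_category K I},
     Hom = icat_hom K,
     Id = (\<lambda>I. (\<lambda>b \<in> carrier (arr I). b, \<lambda>a \<in> carrier (obj I). a)),
     Comp = (\<lambda>I J L (\<phi>', \<psi>') (\<phi>, \<psi>).
       (compose (carrier (arr I)) \<phi>' \<phi>, compose (carrier (obj I)) \<psi>' \<psi>))\<rparr>"

end

theory Submission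
  imports Defs
begin

text \<open>
  A crossed module \<open>\<mu> : M \<rightarrow> A\<close> gives the internal category with arrows \<open>M \<rtimes> A\<close>, where \<open>(m, a)\<close> goes
  from \<open>a\<close> to \<open>\<mu> m + a\<close> and the composite of \<open>(m, a)\<close> and \<open>(n, \<mu> m + a)\<close> is \<open>(m + n, a)\<close>; by (CM2)
  this composition is a homomorphism.  Conversely, the objects of an internal category act on the
  kernel of its source map through the identity map, and the target map restricted to this kernel
  is a crossed module.  Here (CM2) holds because composition is a homomorphism on the pullback.
  The isomorphisms are \<open>m \<mapsto> (m, 0)\<close> and \<open>(m, a) \<mapsto> m + \<sigma> a\<close>.
\<close>

section \<open>Linear and bilinear maps\<close>

lemma linear_mapD:
  assumes "linear_map K V W f"
  shows "x \<in> carrier V \<Longrightarrow> f x \<in> carrier W"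
    and "\<lbrakk>x \<in> carrier V; y \<in> carrier V\<rbrakk> \<Longrightarrow> f (x \<oplus>\<^bsub>V\<^esub> y) = f x \<oplus>\<^bsub>W\<^esub> f y"
    and "\<lbrakk>c \<in> carrier K; x \<in> carrier V\<rbrakk> \<Longrightarrow> f (c \<odot>\<^bsub>V\<^esub> x) = c \<odot>\<^bsub>W\<^esub> f x"
  using assms by (auto simp: linear_map_def)

lemma linear_map_zero:
  assumes "linear_map K V W f" "abelian_group V" "abelian_group W"
  shows "f \<zero>\<^bsub>V\<^esub> = \<zero>\<^bsub>W\<^esub>"
proof -
  interpret V: abelian_group V by fact
  interpret W: abelian_group W by fact
  note f = linear_mapD[OF assms(1)]
  have "f \<zero>\<^bsub>V\<^esub> \<oplus>\<^bsub>W\<^esub> f \<zero>\<^bsub>V\<^esub> = f \<zero>\<^bsub>V\<^esub>"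
    using f(2)[of "\<zero>\<^bsub>V\<^esub>" "\<zero>\<^bsub>V\<^esub>"] by simp
  then show ?thesis
    using f(1) by (metis V.zero_closed W.add.r_cancel_one)
qed

lemma bilinear_mapI:
  assumes "\<And>x y. \<lbrakk>x \<in> carrier U; y \<in> carrier V\<rbrakk> \<Longrightarrow> f x y \<in> carrier W"
    and "\<And>x x' y. \<lbrakk>x \<in> carrier U; x' \<in> carrier U; y \<in> carrier V\<rbrakk>
      \<Longrightarrow> f (x \<oplus>\<^bsub>U\<^esub> x') y = f x y \<oplus>\<^bsub>W\<^esub> f x' y"
    and "\<And>x y y'. \<lbrakk>x \<in> carrier U; y \<in> carrier V; y' \<in> carrier V\<rbrakk>
      \<Longrightarrow> f x (y \<oplus>\<^bsub>V\<^esub> y') = f x y \<oplus>\<^bsub>W\<^esub> f x y'"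
    and "\<And>c x y. \<lbrakk>c \<in> carrier K; x \<in> carrier U; y \<in> carrier V\<rbrakk> \<Longrightarrow> f (c \<odot>\<^bsub>U\<^esub> x) y = c \<odot>\<^bsub>W\<^esub> f x y"
    and "\<And>c x y. \<lbrakk>c \<in> carrier K; x \<in> carrier U; y \<in> carrier V\<rbrakk> \<Longrightarrow> f x (c \<odot>\<^bsub>V\<^esub> y) = c \<odot>\<^bsub>W\<^esub> f x y"
  shows "bilinear_map K U V W f"
  using assms by (simp add: bilinear_map_def linear_map_def)

text \<open>The group hypotheses serve the last two rules: a bilinear map vanishes when either
  argument is zero, by \<open>linear_map_zero\<close> in that argument.\<close>

lemma bilinear_mapD:
  assumes "bilinear_map K U V W f" "abelian_group U" "abelian_group V" "abelian_group W"
  shows "\<lbrakk>x \<in> carrier U; y \<in> carrier V\<rbrakk> \<Longrightarrow> f x y \<in> carrier W"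
    and "\<lbrakk>x \<in> carrier U; x' \<in> carrier U; y \<in> carrier V\<rbrakk>
      \<Longrightarrow> f (x \<oplus>\<^bsub>U\<^esub> x') y = f x y \<oplus>\<^bsub>W\<^esub> f x' y"
    and "\<lbrakk>x \<in> carrier U; y \<in> carrier V; y' \<in> carrier V\<rbrakk>
      \<Longrightarrow> f x (y \<oplus>\<^bsub>V\<^esub> y') = f x y \<oplus>\<^bsub>W\<^esub> f x y'"
    and "\<lbrakk>c \<in> carrier K; x \<in> carrier U; y \<in> carrier V\<rbrakk> \<Longrightarrow> f (c \<odot>\<^bsub>U\<^esub> x) y = c \<odot>\<^bsub>W\<^esub> f x y"
    and "\<lbrakk>c \<in> carrier K; x \<in> carrier U; y \<in> carrier V\<rbrakk> \<Longrightarrow> f x (c \<odot>\<^bsub>V\<^esub> y) = c \<odot>\<^bsub>W\<^esub> f x y"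
    and "y \<in> carrier V \<Longrightarrow> f \<zero>\<^bsub>U\<^esub> y = \<zero>\<^bsub>W\<^esub>"
    and "x \<in> carrier U \<Longrightarrow> f x \<zero>\<^bsub>V\<^esub> = \<zero>\<^bsub>W\<^esub>"
  using assms(1) linear_map_zero[OF _ assms(2,4), of K "\<lambda>x. f x y"]
    linear_map_zero[OF _ assms(3,4), of K "f x"]
  by (simp_all add: bilinear_map_def) (auto simp add: linear_map_def)


section \<open>Algebras with bracket\<close>

lemma algebra_with_bracketI:
  assumes "field K" "abelian_group A"
    and "\<And>c x. \<lbrakk>c \<in> carrier K; x \<in> carrier A\<rbrakk> \<Longrightarrow> c \<odot>\<^bsub>A\<^esub> x \<in> carrier A"
    and "\<And>c d x. \<lbrakk>c \<in> carrier K; d \<in> carrier K; x \<in> carrier A\<rbrakk>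
      \<Longrightarrow> (c \<oplus>\<^bsub>K\<^esub> d) \<odot>\<^bsub>A\<^esub> x = c \<odot>\<^bsub>A\<^esub> x \<oplus>\<^bsub>A\<^esub> d \<odot>\<^bsub>A\<^esub> x"
    and "\<And>c x y. \<lbrakk>c \<in> carrier K; x \<in> carrier A; y \<in> carrier A\<rbrakk>
      \<Longrightarrow> c \<odot>\<^bsub>A\<^esub> (x \<oplus>\<^bsub>A\<^esub> y) = c \<odot>\<^bsub>A\<^esub> x \<oplus>\<^bsub>A\<^esub> c \<odot>\<^bsub>A\<^esub> y"
    and "\<And>c d x. \<lbrakk>c \<in> carrier K; d \<in> carrier K; x \<in> carrier A\<rbrakk>
      \<Longrightarrow> (c \<otimes>\<^bsub>K\<^esub> d) \<odot>\<^bsub>A\<^esub> x = c \<odot>\<^bsub>A\<^esub> (d \<odot>\<^bsub>A\<^esub> x)"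
    and "\<And>x. x \<in> carrier A \<Longrightarrow> \<one>\<^bsub>K\<^esub> \<odot>\<^bsub>A\<^esub> x = x"
    and "bilinear_map K A A A (mult A)" "bilinear_map K A A A (bracket A)"
    and "\<And>a b c. \<lbrakk>a \<in> carrier A; b \<in> carrier A; c \<in> carrier A\<rbrakk>
      \<Longrightarrow> (a \<otimes>\<^bsub>A\<^esub> b) \<otimes>\<^bsub>A\<^esub> c = a \<otimes>\<^bsub>A\<^esub> (b \<otimes>\<^bsub>A\<^esub> c)"
    and "\<And>a b c. \<lbrakk>a \<in> carrier A; b \<in> carrier A; c \<in> carrier A\<rbrakk>
      \<Longrightarrow> bracket A (a \<otimes>\<^bsub>A\<^esub> b) c = bracket A a c \<otimes>\<^bsub>A\<^esub> b \<oplus>\<^bsub>A\<^esub> a \<otimes>\<^bsub>A\<^esub> bracket A b c"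
  shows "algebra_with_bracket K A"
proof -
  interpret K: field K by fact
  show ?thesis
    by (intro algebra_with_bracket.intro algebra_with_bracket_axioms.intro moduleI assms
        K.is_cring)
qed

context algebra_with_bracket
begin

lemmas mult_simps =
  bilinear_mapD[OF mult_bilinear M.abelian_group_axioms M.abelian_group_axioms M.abelian_group_axioms]

lemmas bracket_simps =
  bilinear_mapD[OF bracket_bilinear M.abelian_group_axioms M.abelian_group_axioms M.abelian_group_axioms]

text \<open>Closure under negation comes from closure under scalars, since -x is (-1) x. The laws
  are inherited because only the carrier changes.\<close>

lemma subalgebra:
  assumes S: "S \<subseteq> carrier A" "\<zero>\<^bsub>A\<^esub> \<in> S"
    and "\<And>x y. \<lbrakk>x \<in> S; y \<in> S\<rbrakk> \<Longrightarrow> x \<oplus>\<^bsub>A\<^esub> y \<in> S"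
    and smult: "\<And>c x. \<lbrakk>c \<in> carrier K; x \<in> S\<rbrakk> \<Longrightarrow> c \<odot>\<^bsub>A\<^esub> x \<in> S"
    and "\<And>x y. \<lbrakk>x \<in> S; y \<in> S\<rbrakk> \<Longrightarrow> x \<otimes>\<^bsub>A\<^esub> y \<in> S"
    and "\<And>x y. \<lbrakk>x \<in> S; y \<in> S\<rbrakk> \<Longrightarrow> bracket A x y \<in> S"
  shows "algebra_with_bracket K (A\<lparr>carrier := S\<rparr>)"
proof -
  have neg: "\<exists>y \<in> S. y \<oplus>\<^bsub>A\<^esub> x = \<zero>\<^bsub>A\<^esub>" if "x \<in> S" for x
  proof
    have "x \<in> carrier A"
      using that S by auto
    then show "(\<ominus>\<^bsub>K\<^esub> \<one>\<^bsub>K\<^esub>) \<odot>\<^bsub>A\<^esub> x \<oplus>\<^bsub>A\<^esub> x = \<zero>\<^bsub>A\<^esub>"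
      by (simp add: smult_l_minus M.l_neg)
    show "(\<ominus>\<^bsub>K\<^esub> \<one>\<^bsub>K\<^esub>) \<odot>\<^bsub>A\<^esub> x \<in> S"
      using that by (simp add: smult)
  qed
  have *: "x \<in> S \<Longrightarrow> x \<in> carrier A" for x
    using S by auto
  show ?thesis
    by (intro algebra_with_bracketI abelian_groupI bilinear_mapI)
      (auto simp: assms neg * mult_simps bracket_simps mult_assoc bracket_mult K.field_axioms
        smult_l_distr smult_r_distr smult_assoc1 M.a_assoc intro: M.a_comm)
qed

end

section \<open>Homomorphisms of algebras with bracket\<close>

lemma awb_homD:
  assumes "f \<in> awb_hom K A B"
  shows "f \<in> extensional (carrier A)"
    and "linear_map K A B f"
    and "x \<in> carrier A \<Longrightarrow> f x \<in> carrier B"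
    and "\<lbrakk>x \<in> carrier A; y \<in> carrier A\<rbrakk> \<Longrightarrow> f (x \<oplus>\<^bsub>A\<^esub> y) = f x \<oplus>\<^bsub>B\<^esub> f y"
    and "\<lbrakk>c \<in> carrier K; x \<in> carrier A\<rbrakk> \<Longrightarrow> f (c \<odot>\<^bsub>A\<^esub> x) = c \<odot>\<^bsub>B\<^esub> f x"
    and "\<lbrakk>x \<in> carrier A; y \<in> carrier A\<rbrakk> \<Longrightarrow> f (x \<otimes>\<^bsub>A\<^esub> y) = f x \<otimes>\<^bsub>B\<^esub> f y"
    and "\<lbrakk>x \<in> carrier A; y \<in> carrier A\<rbrakk> \<Longrightarrow> f (bracket A x y) = bracket B (f x) (f y)"
  using assms by (auto simp: awb_hom_def linear_map_def)

lemma awb_homI: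
  assumes "f \<in> extensional (carrier A)"
    and "\<And>x. x \<in> carrier A \<Longrightarrow> f x \<in> carrier B"
    and "\<And>x y. \<lbrakk>x \<in> carrier A; y \<in> carrier A\<rbrakk> \<Longrightarrow> f (x \<oplus>\<^bsub>A\<^esub> y) = f x \<oplus>\<^bsub>B\<^esub> f y"
    and "\<And>c x. \<lbrakk>c \<in> carrier K; x \<in> carrier A\<rbrakk> \<Longrightarrow> f (c \<odot>\<^bsub>A\<^esub> x) = c \<odot>\<^bsub>B\<^esub> f x"
    and "\<And>x y. \<lbrakk>x \<in> carrier A; y \<in> carrier A\<rbrakk> \<Longrightarrow> f (x \<otimes>\<^bsub>A\<^esub> y) = f x \<otimes>\<^bsub>B\<^esub> f y"
    and "\<And>x y. \<lbrakk>x \<in> carrier A; y \<in> carrier A\<rbrakk> \<Longrightarrow> f (bracket A x y) = bracket B (f x) (f y)"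
  shows "f \<in> awb_hom K A B"
  using assms by (simp add: awb_hom_def linear_map_def)

lemma awb_hom_zero:
  assumes "f \<in> awb_hom K A B" "algebra_with_bracket K A" "algebra_with_bracket K B"
  shows "f \<zero>\<^bsub>A\<^esub> = \<zero>\<^bsub>B\<^esub>"
proof -
  interpret A: algebra_with_bracket K A by fact
  interpret B: algebra_with_bracket K B by fact
  show ?thesis
    using awb_homD(2)[OF assms(1)] A.M.abelian_group_axioms B.M.abelian_group_axioms
    by (rule linear_map_zero)
qed

lemma awb_hom_compose:
  assumes "f \<in> awb_hom K A B" "g \<in> awb_hom K B C" "algebra_with_bracket K A"
  shows "compose (carrier A) g f \<in> awb_hom K A C"
proof -
  interpret A: algebra_with_bracket K A by fact
  show ?thesis
    by (rule awb_homI)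
      (simp_all add: compose_def awb_homD[OF assms(1)] awb_homD[OF assms(2)] A.mult_simps A.bracket_simps)
qed

lemma awb_hom_id:
  assumes "algebra_with_bracket K A"
  shows "(\<lambda>x \<in> carrier A. x) \<in> awb_hom K A A"
proof -
  interpret A: algebra_with_bracket K A by fact
  show ?thesis
    by (rule awb_homI) (simp_all add: A.mult_simps A.bracket_simps)
qed

text \<open>Every element of \<open>carrier B\<close> is an image under \<open>f\<close>, so its
  operations can be computed on preimages. Restricting the inverse to \<open>carrier B\<close>
  supplies the extensionality that \<open>awb_hom\<close> demands.\<close>

lemma awb_hom_inv:
  assumes f: "f \<in> awb_hom K A B" and bij: "bij_betw f (carrier A) (carrier B)"
    and A: "algebra_with_bracket K A" and B: "algebra_with_bracket K B"
  shows "(\<lambda>y \<in> carrier B. inv_into (carrier A) f y) \<in> awb_hom K B A"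
proof -
  interpret A: algebra_with_bracket K A by fact
  let ?g = "inv_into (carrier A) f"
  let ?g' = "\<lambda>y \<in> carrier B. ?g y"
  have inj: "inj_on f (carrier A)" and im: "f ` carrier A = carrier B"
    using bij by (auto simp: bij_betw_def)
  have g: "?g y \<in> carrier A" if "y \<in> carrier B" for y
    using that im by (simp add: inv_into_into)
  \<comment> \<open>One argument for all three binary operations: \<open>h\<close> and
    \<open>h'\<close> are later the sums, the products and the brackets of \<open>A\<close> and
    \<open>B\<close>.\<close>
  have op: "?g (h' x y) = h (?g x) (?g y)"
    if xy: "x \<in> carrier B" "y \<in> carrier B"
      and h: "\<And>a b. \<lbrakk>a \<in> carrier A; b \<in> carrier A\<rbrakk> \<Longrightarrow> h a b \<in> carrier A"
        "\<And>a b. \<lbrakk>a \<in> carrier A; b \<in> carrier A\<rbrakk> \<Longrightarrow> f (h a b) = h' (f a) (f b)" for h h' x y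
  proof -
    obtain a b where "a \<in> carrier A" "b \<in> carrier A" "x = f a" "y = f b"
      using xy im by blast
    then show ?thesis
      using h[of a b] inj by (metis inv_into_f_f)
  qed
  have smult: "?g (c \<odot>\<^bsub>B\<^esub> y) = c \<odot>\<^bsub>A\<^esub> ?g y"
    if cy: "c \<in> carrier K" "y \<in> carrier B" for c y
  proof -
    obtain a where "a \<in> carrier A" "y = f a"
      using cy im by blast
    then show ?thesis
      using cy by (simp add: awb_homD(5)[OF f, symmetric] inv_into_f_f[OF inj])
  qed
  interpret B: algebra_with_bracket K B by fact
  show ?thesis
  proof (rule awb_homI)
    fix x y assume xy: "x \<in> carrier B" "y \<in> carrier B"
    show "?g' (x \<oplus>\<^bsub>B\<^esub> y) = ?g' x \<oplus>\<^bsub>A\<^esub> ?g' y"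
      using op[of x y "add A" "add B"] xy by (simp add: awb_homD[OF f])
    show "?g' (x \<otimes>\<^bsub>B\<^esub> y) = ?g' x \<otimes>\<^bsub>A\<^esub> ?g' y"
      using op[of x y "mult A" "mult B"] xy
      by (simp add: awb_homD[OF f] A.mult_simps B.mult_simps)
    show "?g' (bracket B x y) = bracket A (?g' x) (?g' y)"
      using op[of x y "bracket A" "bracket B"] xy
      by (simp add: awb_homD[OF f] A.bracket_simps B.bracket_simps)
  qed (simp_all add: g smult)
qed


section \<open>Semidirect products\<close>

context awb_action
begin

lemmas lact_simps = bilinear_mapD[OF lact_bilinear
  A.M.abelian_group_axioms M.M.abelian_group_axioms M.M.abelian_group_axioms]
lemmas ract_simps = bilinear_mapD[OF ract_bilinear
  M.M.abelian_group_axioms A.M.abelian_group_axioms M.M.abelian_group_axioms]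
lemmas lbr_simps = bilinear_mapD[OF lbr_bilinear
  A.M.abelian_group_axioms M.M.abelian_group_axioms M.M.abelian_group_axioms]
lemmas rbr_simps = bilinear_mapD[OF rbr_bilinear
  M.M.abelian_group_axioms A.M.abelian_group_axioms M.M.abelian_group_axioms]

lemmas bilinear_simps = A.mult_simps A.bracket_simps M.mult_simps M.bracket_simps
  lact_simps ract_simps lbr_simps rbr_simps

text \<open>These are the eight cases of (xy)z = x(yz) with each factor in M or in A. All are
  oriented to move parentheses to the right, hence the two reversed laws.\<close>

lemmas right_assoc_simps = A.mult_assoc M.mult_assoc
  lact_mult ract_mult[symmetric] lact_ract mult_ract mult_lact[symmetric] ract_mult_lact

text \<open>Likewise the eight cases of [xy, z] = [x, z] y + x [y, z] with x, y, z each in M or in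
  A.\<close>

lemmas derivation_simps = A.bracket_mult M.bracket_mult
  rbr_lact rbr_ract lbr_mult bracket_ract bracket_lact rbr_mult

end

text \<open>
  An object of either category lives on subsets of one type, so the semidirect product is carried
  by codes \<open>pr m a\<close> of the pairs \<open>(m, a)\<close>.
\<close>

locale pairing =
  fixes pr :: "'m \<Rightarrow> 'a \<Rightarrow> 'p" and p :: "'p \<Rightarrow> 'm" and q :: "'p \<Rightarrow> 'a"
  assumes p_pr [simp]: "p (pr m a) = m"
    and q_pr [simp]: "q (pr m a) = a"
    and pr_p_q [simp]: "pr (p u) (q u) = u"
begin

lemma pr_eqI: "p u = p v \<Longrightarrow> q u = q v \<Longrightarrow> u = v"
  by (metis pr_p_q)

text \<open>With the pair (m, a) read as a formal sum m + a, product and bracket are the bilinear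
  expansions: the terms involving M go to the first coordinate, the one purely in A to the
  second.\<close>

definition semidirect :: "('k, 'a) awb \<Rightarrow> ('k, 'm) awb \<Rightarrow> ('a, 'm) awb_act \<Rightarrow> ('k, 'p) awb" where
  "semidirect A M act = \<lparr>
     carrier = {u. p u \<in> carrier M \<and> q u \<in> carrier A},
     mult = (\<lambda>u v. pr (p u \<otimes>\<^bsub>M\<^esub> p v \<oplus>\<^bsub>M\<^esub> lact act (q u) (p v) \<oplus>\<^bsub>M\<^esub> ract act (p u) (q v))
       (q u \<otimes>\<^bsub>A\<^esub> q v)),
     one = pr \<one>\<^bsub>M\<^esub> \<one>\<^bsub>A\<^esub>,
     zero = pr \<zero>\<^bsub>M\<^esub> \<zero>\<^bsub>A\<^esub>,
     add = (\<lambda>u v. pr (p u \<oplus>\<^bsub>M\<^esub> p v) (q u \<oplus>\<^bsub>A\<^esub> q v)),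
     smult = (\<lambda>c u. pr (c \<odot>\<^bsub>M\<^esub> p u) (c \<odot>\<^bsub>A\<^esub> q u)),
     bracket = (\<lambda>u v. pr
       (bracket M (p u) (p v) \<oplus>\<^bsub>M\<^esub> lbr act (q u) (p v) \<oplus>\<^bsub>M\<^esub> rbr act (p u) (q v))
       (bracket A (q u) (q v)))\<rparr>"

text \<open>After bilinear expansion, associativity splits into the cases of
  \<open>right_assoc_simps\<close> and the bracket law into those of
  \<open>derivation_simps\<close>; commutativity of addition matches the summands.\<close>

lemma semidirect_awb:
  assumes "awb_action K A M act"
  shows "algebra_with_bracket K (semidirect A M act)"
proof -
  interpret awb_action K A M act by fact
  note comps = A.smult_l_distr A.smult_r_distr A.smult_assoc1
    M.smult_l_distr M.smult_r_distr M.smult_assoc1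
  show ?thesis
  proof (rule algebra_with_bracketI)
    show "abelian_group (semidirect A M act)"
    proof (rule abelian_groupI)
      fix u assume u: "u \<in> carrier (semidirect A M act)"
      then show "\<exists>v \<in> carrier (semidirect A M act).
          v \<oplus>\<^bsub>semidirect A M act\<^esub> u = \<zero>\<^bsub>semidirect A M act\<^esub>"
        by (intro bexI[of _ "pr (\<ominus>\<^bsub>M\<^esub> p u) (\<ominus>\<^bsub>A\<^esub> q u)"])
          (simp_all add: semidirect_def M.M.l_neg A.M.l_neg)
    qed (simp_all add: semidirect_def M.M.a_ac A.M.a_ac)
    show "bilinear_map K (semidirect A M act) (semidirect A M act) (semidirect A M act)
        (mult (semidirect A M act))"
      by (rule bilinear_mapI)
        (simp_all add: semidirect_def bilinear_simps comps M.M.a_ac)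
    show "bilinear_map K (semidirect A M act) (semidirect A M act) (semidirect A M act)
        (bracket (semidirect A M act))"
      by (rule bilinear_mapI)
        (simp_all add: semidirect_def bilinear_simps comps M.M.a_ac)
  next
    fix u v w
    assume "u \<in> carrier (semidirect A M act)" "v \<in> carrier (semidirect A M act)"
      "w \<in> carrier (semidirect A M act)"
    then have uvw: "p u \<in> carrier M" "p v \<in> carrier M" "p w \<in> carrier M"
      "q u \<in> carrier A" "q v \<in> carrier A" "q w \<in> carrier A"
      by (simp_all add: semidirect_def)
    show "(u \<otimes>\<^bsub>semidirect A M act\<^esub> v) \<otimes>\<^bsub>semidirect A M act\<^esub> w
        = u \<otimes>\<^bsub>semidirect A M act\<^esub> (v \<otimes>\<^bsub>semidirect A M act\<^esub> w)"
      using uvw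
      by (simp add: semidirect_def bilinear_simps right_assoc_simps M.M.a_ac)
    show "bracket (semidirect A M act) (u \<otimes>\<^bsub>semidirect A M act\<^esub> v) w
        = bracket (semidirect A M act) u w \<otimes>\<^bsub>semidirect A M act\<^esub> v
          \<oplus>\<^bsub>semidirect A M act\<^esub> u \<otimes>\<^bsub>semidirect A M act\<^esub> bracket (semidirect A M act) v w"
      using uvw
      by (simp add: semidirect_def bilinear_simps derivation_simps M.M.a_ac)
  qed (simp_all add: semidirect_def comps A.K.field_axioms)
qed

end


section \<open>The two categories\<close>

lemma XAWB_simps [simp]:
  "Obj (XAWB K) = {X. crossed_module K X}"
  "Hom (XAWB K) = xmod_hom K"
  "Id (XAWB K) X = (\<lambda>m \<in> carrier (upper X). m, \<lambda>a \<in> carrier (base X). a)"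
  "Comp (XAWB K) X Y Z (\<alpha>', \<beta>') (\<alpha>, \<beta>)
    = (compose (carrier (upper X)) \<alpha>' \<alpha>, compose (carrier (base X)) \<beta>' \<beta>)"
  by (simp_all add: XAWB_def)

lemma IAWB_simps [simp]:
  "Obj (IAWB K) = {I. internal_category K I}"
  "Hom (IAWB K) = icat_hom K"
  "Id (IAWB K) I = (\<lambda>b \<in> carrier (arr I). b, \<lambda>a \<in> carrier (obj I). a)"
  "Comp (IAWB K) I J L (\<phi>', \<psi>') (\<phi>, \<psi>)
    = (compose (carrier (arr I)) \<phi>' \<phi>, compose (carrier (obj I)) \<psi>' \<psi>)"
  by (simp_all add: IAWB_def)

lemma xmod_homD:
  assumes "(\<alpha>, \<beta>) \<in> xmod_hom K X Y"
  shows "\<alpha> \<in> awb_hom K (upper X) (upper Y)" "\<beta> \<in> awb_hom K (base X) (base Y)"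
    and "m \<in> carrier (upper X) \<Longrightarrow> \<beta> (bdry X m) = bdry Y (\<alpha> m)"
    and "\<lbrakk>a \<in> carrier (base X); m \<in> carrier (upper X)\<rbrakk>
      \<Longrightarrow> \<alpha> (lact (action X) a m) = lact (action Y) (\<beta> a) (\<alpha> m)"
    and "\<lbrakk>a \<in> carrier (base X); m \<in> carrier (upper X)\<rbrakk>
      \<Longrightarrow> \<alpha> (ract (action X) m a) = ract (action Y) (\<alpha> m) (\<beta> a)"
    and "\<lbrakk>a \<in> carrier (base X); m \<in> carrier (upper X)\<rbrakk>
      \<Longrightarrow> \<alpha> (lbr (action X) a m) = lbr (action Y) (\<beta> a) (\<alpha> m)"
    and "\<lbrakk>a \<in> carrier (base X); m \<in> carrier (upper X)\<rbrakk>
      \<Longrightarrow> \<alpha> (rbr (action X) m a) = rbr (action Y) (\<alpha> m) (\<beta> a)"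
  using assms by (simp_all add: xmod_hom_def)

lemma icat_homD:
  assumes "(\<phi>, \<psi>) \<in> icat_hom K I J"
  shows "\<phi> \<in> awb_hom K (arr I) (arr J)" "\<psi> \<in> awb_hom K (obj I) (obj J)"
    and "b \<in> carrier (arr I) \<Longrightarrow> \<psi> (src I b) = src J (\<phi> b)"
    and "b \<in> carrier (arr I) \<Longrightarrow> \<psi> (trg I b) = trg J (\<phi> b)"
    and "a \<in> carrier (obj I) \<Longrightarrow> \<phi> (idn I a) = idn J (\<psi> a)"
    and "\<lbrakk>b1 \<in> carrier (arr I); b2 \<in> carrier (arr I); trg I b1 = src I b2\<rbrakk>
      \<Longrightarrow> \<phi> (cmp I (b1, b2)) = cmp J (\<phi> b1, \<phi> b2)"
  using assms by (simp_all add: icat_hom_def)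

context crossed_module
begin

lemmas bdry_simps = awb_homD(3-7)[OF bdry_hom]

lemma bdry_zero: "bdry X \<zero>\<^bsub>upper X\<^esub> = \<zero>\<^bsub>base X\<^esub>"
  using bdry_hom M.algebra_with_bracket_axioms A.algebra_with_bracket_axioms
  by (rule awb_hom_zero)

end

context internal_category
begin

lemmas src_simps = awb_homD(3-7)[OF src_hom]
lemmas trg_simps = awb_homD(3-7)[OF trg_hom]
lemmas idn_simps = awb_homD(3-7)[OF idn_hom]

lemma src_zero: "src I \<zero>\<^bsub>arr I\<^esub> = \<zero>\<^bsub>obj I\<^esub>"
  using src_hom B.algebra_with_bracket_axioms A.algebra_with_bracket_axioms
  by (rule awb_hom_zero)

lemma trg_zero: "trg I \<zero>\<^bsub>arr I\<^esub> = \<zero>\<^bsub>obj I\<^esub>"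
  using trg_hom B.algebra_with_bracket_axioms A.algebra_with_bracket_axioms
  by (rule awb_hom_zero)

lemma idn_zero: "idn I \<zero>\<^bsub>obj I\<^esub> = \<zero>\<^bsub>arr I\<^esub>"
  using idn_hom A.algebra_with_bracket_axioms B.algebra_with_bracket_axioms
  by (rule awb_hom_zero)

lemma cmp_closed:
  "\<lbrakk>b1 \<in> carrier (arr I); b2 \<in> carrier (arr I); trg I b1 = src I b2\<rbrakk>
    \<Longrightarrow> cmp I (b1, b2) \<in> carrier (arr I)"
  using awb_homD(3)[OF cmp_hom, of "(b1, b2)"] by (simp add: awb_pullback_def)

end

lemma category_XAWB: "category (XAWB K)"
proof
  fix X assume "X \<in> Obj (XAWB K)"
  then interpret crossed_module K X by simp
  show "Id (XAWB K) X \<in> Hom (XAWB K) X X"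
    by (simp add: xmod_hom_def bilinear_simps bdry_simps
        awb_hom_id A.algebra_with_bracket_axioms M.algebra_with_bracket_axioms)
next
  fix X Y Z f g
  assume "X \<in> Obj (XAWB K)" and fg: "f \<in> Hom (XAWB K) X Y" "g \<in> Hom (XAWB K) Y Z"
  then interpret crossed_module K X by simp
  obtain \<alpha> \<beta> where f: "f = (\<alpha>, \<beta>)" by force
  obtain \<alpha>' \<beta>' where g: "g = (\<alpha>', \<beta>')" by force
  note F = xmod_homD[OF fg(1)[unfolded f XAWB_simps]]
  note G = xmod_homD[OF fg(2)[unfolded g XAWB_simps]]
  have "compose (carrier (upper X)) \<alpha>' \<alpha> \<in> awb_hom K (upper X) (upper Z)"
    "compose (carrier (base X)) \<beta>' \<beta> \<in> awb_hom K (base X) (base Z)"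
    using awb_hom_compose F(1,2) G(1,2) A.algebra_with_bracket_axioms
      M.algebra_with_bracket_axioms by blast+
  then show "Comp (XAWB K) X Y Z g f \<in> Hom (XAWB K) X Z"
    by (simp add: f g xmod_hom_def compose_def bilinear_simps bdry_simps F G
        awb_homD(3)[OF F(1)] awb_homD(3)[OF F(2)])
\<comment> \<open>The unit laws are equalities of total functions; they hold off the carriers
  because the components are extensional.\<close>
qed (auto simp: xmod_hom_def awb_homD(1) awb_homD(3) Pi_def intro!: Id_compose compose_Id
    compose_assoc)

lemma category_IAWB: "category (IAWB K)"
proof
  fix I assume "I \<in> Obj (IAWB K)"
  then interpret internal_category K I by simp
  show "Id (IAWB K) I \<in> Hom (IAWB K) I I"
    by (simp add: icat_hom_def src_simps trg_simps idn_simps cmp_closed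
        awb_hom_id A.algebra_with_bracket_axioms B.algebra_with_bracket_axioms)
next
  fix X Y Z f g
  assume "X \<in> Obj (IAWB K)" and fg: "f \<in> Hom (IAWB K) X Y" "g \<in> Hom (IAWB K) Y Z"
  then interpret internal_category K X by simp
  obtain \<alpha> \<beta> where f: "f = (\<alpha>, \<beta>)" by force
  obtain \<alpha>' \<beta>' where g: "g = (\<alpha>', \<beta>')" by force
  note F = icat_homD[OF fg(1)[unfolded f IAWB_simps]]
  note G = icat_homD[OF fg(2)[unfolded g IAWB_simps]]
  have "compose (carrier (arr X)) \<alpha>' \<alpha> \<in> awb_hom K (arr X) (arr Z)"
    "compose (carrier (obj X)) \<beta>' \<beta> \<in> awb_hom K (obj X) (obj Z)"
    using awb_hom_compose F(1,2) G(1,2) A.algebra_with_bracket_axioms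
      B.algebra_with_bracket_axioms by blast+
  \<comment> \<open>The second morphism preserves composites of composable pairs only, so the images
    under the first must be composable in \<open>Y\<close>.\<close>
  moreover have "trg Y (\<alpha> b1) = src Y (\<alpha> b2)"
    if "b1 \<in> carrier (arr X)" "b2 \<in> carrier (arr X)" "trg X b1 = src X b2" for b1 b2
    using that F(3)[of b2] F(4)[of b1] by simp
  ultimately show "Comp (IAWB K) X Y Z g f \<in> Hom (IAWB K) X Z"
    by (simp add: f g icat_hom_def compose_def src_simps trg_simps idn_simps cmp_closed F G
        awb_homD(3)[OF F(1)] awb_homD(3)[OF F(2)])
qed (auto simp: icat_hom_def awb_homD(1) awb_homD(3) Pi_def intro!: Id_compose compose_Id
    compose_assoc)

section \<open>Bijective morphisms are isomorphisms\<close>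

lemma cat_iso_XAWB:
  assumes X: "crossed_module K X" and Y: "crossed_module K Y"
    and hom: "(\<alpha>, \<beta>) \<in> xmod_hom K X Y"
    and bij: "bij_betw \<alpha> (carrier (upper X)) (carrier (upper Y))"
      "bij_betw \<beta> (carrier (base X)) (carrier (base Y))"
  shows "cat_iso (XAWB K) X Y (\<alpha>, \<beta>)"
proof -
  interpret X: crossed_module K X by fact
  interpret Y: crossed_module K Y by fact
  let ?a = "\<lambda>n \<in> carrier (upper Y). inv_into (carrier (upper X)) \<alpha> n"
  let ?b = "\<lambda>b \<in> carrier (base Y). inv_into (carrier (base X)) \<beta> b"
  note h = xmod_homD[OF hom]
  \<comment> \<open>Reversed, the preservation laws pull \<open>\<alpha>\<close> and
    \<open>\<beta>\<close> outermost, where \<open>inv\<close> cancels them.\<close>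
  note h_sym = h(3-7)[symmetric]
  note inv = inv_into_f_f[OF bij_betw_imp_inj_on[OF bij(1)]]
    inv_into_f_f[OF bij_betw_imp_inj_on[OF bij(2)]]
  have surj: "\<exists>m \<in> carrier (upper X). n = \<alpha> m" if "n \<in> carrier (upper Y)" for n
    using that bij(1) by (auto simp: bij_betw_def)
  have surj': "\<exists>a \<in> carrier (base X). b = \<beta> a" if "b \<in> carrier (base Y)" for b
    using that bij(2) by (auto simp: bij_betw_def)
  have closed: "\<alpha> m \<in> carrier (upper Y)" if "m \<in> carrier (upper X)" for m
    using that by (rule awb_homD(3)[OF h(1)])
  have closed': "\<beta> a \<in> carrier (base Y)" if "a \<in> carrier (base X)" for a
    using that by (rule awb_homD(3)[OF h(2)])
  have "?a \<in> awb_hom K (upper Y) (upper X)" "?b \<in> awb_hom K (base Y) (base X)"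
    by (intro awb_hom_inv h bij X.A.algebra_with_bracket_axioms X.M.algebra_with_bracket_axioms
        Y.A.algebra_with_bracket_axioms Y.M.algebra_with_bracket_axioms)+
  moreover have "?b (bdry Y n) = bdry X (?a n)" if "n \<in> carrier (upper Y)" for n
    using surj[OF that] by (auto simp: h_sym inv closed closed' X.bdry_simps)
  moreover have "?a (lact (action Y) b n) = lact (action X) (?b b) (?a n)"
    "?a (ract (action Y) n b) = ract (action X) (?a n) (?b b)"
    "?a (lbr (action Y) b n) = lbr (action X) (?b b) (?a n)"
    "?a (rbr (action Y) n b) = rbr (action X) (?a n) (?b b)"
    if "n \<in> carrier (upper Y)" "b \<in> carrier (base Y)" for n b
    using surj[OF that(1)] surj'[OF that(2)]
    by (auto simp: h_sym inv closed closed' X.bilinear_simps)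
  ultimately have "(?a, ?b) \<in> xmod_hom K Y X"
    by (simp add: xmod_hom_def)
  then show ?thesis
    unfolding cat_iso_def
    by (intro conjI bexI[of _ "(?a, ?b)"])
      (simp_all add: hom compose_inv_into_id[OF bij(1)] compose_inv_into_id[OF bij(2)]
        compose_id_inv_into[OF bij_betw_imp_surj_on[OF bij(1)]]
        compose_id_inv_into[OF bij_betw_imp_surj_on[OF bij(2)]])
qed

lemma cat_iso_IAWB:
  assumes I: "internal_category K I" and J: "internal_category K J"
    and hom: "(\<phi>, \<psi>) \<in> icat_hom K I J"
    and bij: "bij_betw \<phi> (carrier (arr I)) (carrier (arr J))"
      "bij_betw \<psi> (carrier (obj I)) (carrier (obj J))"
  shows "cat_iso (IAWB K) I J (\<phi>, \<psi>)"
proof -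
  interpret I: internal_category K I by fact
  interpret J: internal_category K J by fact
  let ?a = "\<lambda>b \<in> carrier (arr J). inv_into (carrier (arr I)) \<phi> b"
  let ?b = "\<lambda>a \<in> carrier (obj J). inv_into (carrier (obj I)) \<psi> a"
  note h = icat_homD[OF hom]
  note h_sym = h(3-5)[symmetric]
  note inj = bij_betw_imp_inj_on[OF bij(1)] bij_betw_imp_inj_on[OF bij(2)]
  note inv = inv_into_f_f[OF inj(1)] inv_into_f_f[OF inj(2)]
  have surj: "\<exists>c \<in> carrier (arr I). b = \<phi> c" if "b \<in> carrier (arr J)" for b
    using that bij(1) by (auto simp: bij_betw_def)
  have surj': "\<exists>c \<in> carrier (obj I). a = \<psi> c" if "a \<in> carrier (obj J)" for a
    using that bij(2) by (auto simp: bij_betw_def)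
  have closed: "\<phi> b \<in> carrier (arr J)" if "b \<in> carrier (arr I)" for b
    using that by (rule awb_homD(3)[OF h(1)])
  have closed': "\<psi> a \<in> carrier (obj J)" if "a \<in> carrier (obj I)" for a
    using that by (rule awb_homD(3)[OF h(2)])
  have "?a \<in> awb_hom K (arr J) (arr I)" "?b \<in> awb_hom K (obj J) (obj I)"
    by (intro awb_hom_inv h bij I.A.algebra_with_bracket_axioms I.B.algebra_with_bracket_axioms
        J.A.algebra_with_bracket_axioms J.B.algebra_with_bracket_axioms)+
  moreover have "?b (src J b) = src I (?a b)" "?b (trg J b) = trg I (?a b)"
    if "b \<in> carrier (arr J)" for b
    using surj[OF that] by (auto simp: h_sym inv closed closed' I.src_simps I.trg_simps)
  moreover have "?a (idn J a) = idn I (?b a)" if "a \<in> carrier (obj J)" for a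
    using surj'[OF that] by (auto simp: h_sym inv closed closed' I.idn_simps)
  moreover have "?a (cmp J (b1, b2)) = cmp I (?a b1, ?a b2)"
    if b: "b1 \<in> carrier (arr J)" "b2 \<in> carrier (arr J)" "trg J b1 = src J b2" for b1 b2
  proof -
    obtain c1 c2 where c: "c1 \<in> carrier (arr I)" "c2 \<in> carrier (arr I)" "b1 = \<phi> c1" "b2 = \<phi> c2"
      using surj b(1,2) by blast
    \<comment> \<open>Injectivity of \<open>\<psi>\<close> reflects composability, so a composable
      pair in \<open>J\<close> lifts to a composable pair in \<open>I\<close>.\<close>
    have "trg I c1 = src I c2"
      using c b(3) inj_onD[OF inj(2), of "trg I c1" "src I c2"]
      by (simp add: h_sym I.src_simps I.trg_simps)
    then show ?thesis
      using c by (simp add: h(6)[symmetric] inv closed I.cmp_closed)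
  qed
  ultimately have "(?a, ?b) \<in> icat_hom K J I"
    by (simp add: icat_hom_def)
  then show ?thesis
    unfolding cat_iso_def
    by (intro conjI bexI[of _ "(?a, ?b)"])
      (simp_all add: hom compose_inv_into_id[OF bij(1)] compose_inv_into_id[OF bij(2)]
        compose_id_inv_into[OF bij_betw_imp_surj_on[OF bij(1)]]
        compose_id_inv_into[OF bij_betw_imp_surj_on[OF bij(2)]])
qed


section \<open>From crossed modules to internal categories\<close>

locale universe_pairing = pairing pr p q
  for pr :: "'u \<Rightarrow> 'u \<Rightarrow> 'u" and p q
begin

definition total :: "('k, 'u) xmod \<Rightarrow> ('k, 'u) awb" where
  "total X = semidirect (base X) (upper X) (action X)"

text \<open>All structure maps are restricted because homomorphisms are extensional. The domain of
  \<open>cmp\<close> is the carrier of the pullback with source and target written out.\<close>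

definition icat_of :: "('k, 'u) xmod \<Rightarrow> ('k, 'u) icat" where
  "icat_of X = \<lparr>
     arr = total X,
     obj = base X,
     src = \<lambda>u \<in> carrier (total X). q u,
     trg = \<lambda>u \<in> carrier (total X). bdry X (p u) \<oplus>\<^bsub>base X\<^esub> q u,
     idn = \<lambda>a \<in> carrier (base X). pr \<zero>\<^bsub>upper X\<^esub> a,
     cmp = \<lambda>(u, v) \<in> {(u, v). u \<in> carrier (total X) \<and> v \<in> carrier (total X) \<and>
         bdry X (p u) \<oplus>\<^bsub>base X\<^esub> q u = q v}. pr (p u \<oplus>\<^bsub>upper X\<^esub> p v) (q u)\<rparr>"

lemma icat_of_simps [simp]:
  "arr (icat_of X) = total X"
  "obj (icat_of X) = base X"
  "u \<in> carrier (total X) \<Longrightarrow> src (icat_of X) u = q u"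
  "u \<in> carrier (total X) \<Longrightarrow> trg (icat_of X) u = bdry X (p u) \<oplus>\<^bsub>base X\<^esub> q u"
  "a \<in> carrier (base X) \<Longrightarrow> idn (icat_of X) a = pr \<zero>\<^bsub>upper X\<^esub> a"
  "\<lbrakk>u \<in> carrier (total X); v \<in> carrier (total X); bdry X (p u) \<oplus>\<^bsub>base X\<^esub> q u = q v\<rbrakk>
    \<Longrightarrow> cmp (icat_of X) (u, v) = pr (p u \<oplus>\<^bsub>upper X\<^esub> p v) (q u)"
  by (simp_all add: icat_of_def)

lemma icat_of_ext:
  "src (icat_of X) \<in> extensional (carrier (total X))"
  "trg (icat_of X) \<in> extensional (carrier (total X))"
  "idn (icat_of X) \<in> extensional (carrier (base X))"
  "cmp (icat_of X) \<in> extensional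
    (carrier (awb_pullback (total X) (trg (icat_of X)) (src (icat_of X))))"
  by (auto simp: icat_of_def awb_pullback_def extensional_def)

lemma carrier_total [simp]:
  "u \<in> carrier (total X) \<longleftrightarrow> p u \<in> carrier (upper X) \<and> q u \<in> carrier (base X)"
  by (simp add: total_def semidirect_def)

lemma total_ops [simp]:
  "u \<otimes>\<^bsub>total X\<^esub> v = pr (p u \<otimes>\<^bsub>upper X\<^esub> p v \<oplus>\<^bsub>upper X\<^esub> lact (action X) (q u) (p v)
    \<oplus>\<^bsub>upper X\<^esub> ract (action X) (p u) (q v)) (q u \<otimes>\<^bsub>base X\<^esub> q v)"
  "\<zero>\<^bsub>total X\<^esub> = pr \<zero>\<^bsub>upper X\<^esub> \<zero>\<^bsub>base X\<^esub>"
  "u \<oplus>\<^bsub>total X\<^esub> v = pr (p u \<oplus>\<^bsub>upper X\<^esub> p v) (q u \<oplus>\<^bsub>base X\<^esub> q v)"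
  "c \<odot>\<^bsub>total X\<^esub> u = pr (c \<odot>\<^bsub>upper X\<^esub> p u) (c \<odot>\<^bsub>base X\<^esub> q u)"
  "bracket (total X) u v = pr
    (bracket (upper X) (p u) (p v) \<oplus>\<^bsub>upper X\<^esub> lbr (action X) (q u) (p v)
      \<oplus>\<^bsub>upper X\<^esub> rbr (action X) (p u) (q v)) (bracket (base X) (q u) (q v))"
  by (simp_all add: total_def semidirect_def)

text \<open>(CM1) makes the target a homomorphism: the boundary turns the mixed terms of a product
  or bracket in M \<rtimes> A into the mixed terms of the product or bracket of the targets (\<mu> m
  + a) and (\<mu> n + b).\<close>

lemma internal_category_icat_of:
  assumes "crossed_module K X"
  shows "internal_category K (icat_of X)"
proof -
  interpret crossed_module K X by fact
  interpret S: algebra_with_bracket K "total X"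
    unfolding total_def by (rule semidirect_awb) (rule awb_action_axioms)
  note simps = bilinear_simps bdry_simps bdry_zero CM1 CM2 A.M.a_ac M.M.a_ac
    A.smult_r_distr M.smult_r_distr
  have hom: "src (icat_of X) \<in> awb_hom K (total X) (base X)"
    "trg (icat_of X) \<in> awb_hom K (total X) (base X)"
    "idn (icat_of X) \<in> awb_hom K (base X) (total X)"
    by (rule awb_homI; simp add: simps icat_of_ext)+
  have cmp: "cmp (icat_of X) \<in> awb_hom K
      (awb_pullback (total X) (trg (icat_of X)) (src (icat_of X))) (total X)" (is "_ \<in> awb_hom K ?P _")
  proof (rule awb_homI)
    show "cmp (icat_of X) \<in> extensional (carrier ?P)"
      by (rule icat_of_ext)
  next
    fix x assume "x \<in> carrier ?P"
    then show "cmp (icat_of X) x \<in> carrier (total X)"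
      by (auto simp: awb_pullback_def)
  next
    fix c x assume "c \<in> carrier K" "x \<in> carrier ?P"
    \<comment> \<open>Composability determines \<open>q v\<close>, so a composable pair is described
      by \<open>p u\<close>, \<open>q u\<close> and \<open>p v\<close> alone.\<close>
    then obtain u v where x: "x = (u, v)"
      and car: "c \<in> carrier K" "p u \<in> carrier (upper X)" "q u \<in> carrier (base X)"
        "p v \<in> carrier (upper X)"
      and q: "q v = bdry X (p u) \<oplus>\<^bsub>base X\<^esub> q u"
      by (auto simp: awb_pullback_def)
    show "cmp (icat_of X) (c \<odot>\<^bsub>?P\<^esub> x) = c \<odot>\<^bsub>total X\<^esub> cmp (icat_of X) x"
      using car by (simp add: x q awb_pullback_def simps)
  next
    fix x y assume "x \<in> carrier ?P" "y \<in> carrier ?P"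
    then obtain u v u' v' where x: "x = (u, v)" and y: "y = (u', v')"
      and car: "p u \<in> carrier (upper X)" "q u \<in> carrier (base X)" "p v \<in> carrier (upper X)"
        "p u' \<in> carrier (upper X)" "q u' \<in> carrier (base X)" "p v' \<in> carrier (upper X)"
      and q: "q v = bdry X (p u) \<oplus>\<^bsub>base X\<^esub> q u" "q v' = bdry X (p u') \<oplus>\<^bsub>base X\<^esub> q u'"
      by (auto simp: awb_pullback_def)
    \<comment> \<open>For products, with m, n, m', n' the first coordinates of u, v, u', v': the
      composite of the products contains \<mu>(m) n' and n \<mu>(m') where the product of the
      composites has the cross terms m n' and n m' of (m + n)(m' + n'). (CM2) identifies them, and
      likewise for brackets.\<close>
    show "cmp (icat_of X) (x \<oplus>\<^bsub>?P\<^esub> y) = cmp (icat_of X) x \<oplus>\<^bsub>total X\<^esub> cmp (icat_of X) y"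
      "cmp (icat_of X) (x \<otimes>\<^bsub>?P\<^esub> y) = cmp (icat_of X) x \<otimes>\<^bsub>total X\<^esub> cmp (icat_of X) y"
      "cmp (icat_of X) (bracket ?P x y) = bracket (total X) (cmp (icat_of X) x) (cmp (icat_of X) y)"
      using car by (simp_all add: x y q awb_pullback_def simps)
  qed
  have assoc: "cmp (icat_of X) (cmp (icat_of X) (u, v), w) = cmp (icat_of X) (u, cmp (icat_of X) (v, w))"
    if "u \<in> carrier (arr (icat_of X))" "v \<in> carrier (arr (icat_of X))" "w \<in> carrier (arr (icat_of X))"
      "trg (icat_of X) u = src (icat_of X) v" "trg (icat_of X) v = src (icat_of X) w" for u v w
  proof -
    have car: "p u \<in> carrier (upper X)" "q u \<in> carrier (base X)"
      "p v \<in> carrier (upper X)" "p w \<in> carrier (upper X)"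
      and q: "q v = bdry X (p u) \<oplus>\<^bsub>base X\<^esub> q u" "q w = bdry X (p v) \<oplus>\<^bsub>base X\<^esub> q v"
      using that by simp_all
    then show ?thesis
      by (simp add: q simps)
  qed
  show ?thesis
  proof (intro internal_category.intro internal_category_axioms.intro)
    fix u v
    assume uv: "u \<in> carrier (arr (icat_of X))" "v \<in> carrier (arr (icat_of X))"
      "trg (icat_of X) u = src (icat_of X) v"
    then have q: "q v = bdry X (p u) \<oplus>\<^bsub>base X\<^esub> q u"
      by simp
    show "src (icat_of X) (cmp (icat_of X) (u, v)) = src (icat_of X) u"
      "trg (icat_of X) (cmp (icat_of X) (u, v)) = trg (icat_of X) v"
      using uv(1,2) by (simp_all add: q simps)
  next
    fix u v w
    assume "u \<in> carrier (arr (icat_of X))" "v \<in> carrier (arr (icat_of X))"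
      "w \<in> carrier (arr (icat_of X))"
      "trg (icat_of X) u = src (icat_of X) v" "trg (icat_of X) v = src (icat_of X) w"
    then show "cmp (icat_of X) (cmp (icat_of X) (u, v), w)
        = cmp (icat_of X) (u, cmp (icat_of X) (v, w))"
      by (rule assoc)
  qed (simp_all add: hom cmp simps pr_eqI
      A.algebra_with_bracket_axioms S.algebra_with_bracket_axioms)
qed

definition icat_map ::
    "('k, 'u) xmod \<Rightarrow> ('u \<Rightarrow> 'u) \<times> ('u \<Rightarrow> 'u) \<Rightarrow> ('u \<Rightarrow> 'u) \<times> ('u \<Rightarrow> 'u)" where
  "icat_map X = (\<lambda>(\<alpha>, \<beta>). (\<lambda>u \<in> carrier (total X). pr (\<alpha> (p u)) (\<beta> (q u)), \<beta>))"

lemma cat_functor_icat_of: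
  fixes K :: "('k, 'r) ring_scheme"
  shows "cat_functor (XAWB K) (IAWB K) icat_of (\<lambda>X Y. icat_map X)"
proof (intro cat_functor.intro cat_functor_axioms.intro category_XAWB category_IAWB)
  fix X :: "('k, 'u) xmod" assume "X \<in> Obj (XAWB K)"
  then show "icat_of X \<in> Obj (IAWB K)"
    by (simp add: internal_category_icat_of)
next
  fix X :: "('k, 'u) xmod" assume "X \<in> Obj (XAWB K)"
  show "icat_map X (Id (XAWB K) X) = Id (IAWB K) (icat_of X)"
    by (auto simp: icat_map_def)
next
  fix X Y :: "('k, 'u) xmod" and f
  assume "X \<in> Obj (XAWB K)" "Y \<in> Obj (XAWB K)" and f: "f \<in> Hom (XAWB K) X Y"
  then interpret X: crossed_module K X + Y: crossed_module K Y by simp_all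
  obtain \<alpha> \<beta> where f_eq: "f = (\<alpha>, \<beta>)" by force
  note h = xmod_homD[OF f[unfolded f_eq XAWB_simps]]
  note simps = awb_homD(3-7)[OF h(1)] awb_homD(3-7)[OF h(2)] h(4-7) X.bilinear_simps
  have zero: "\<alpha> \<zero>\<^bsub>upper X\<^esub> = \<zero>\<^bsub>upper Y\<^esub>"
    using h(1) X.M.algebra_with_bracket_axioms Y.M.algebra_with_bracket_axioms
    by (rule awb_hom_zero)
  have bdry: "bdry Y (\<alpha> m) = \<beta> (bdry X m)" if "m \<in> carrier (upper X)" for m
    using h(3) that by simp
  have "(\<lambda>u \<in> carrier (total X). pr (\<alpha> (p u)) (\<beta> (q u))) \<in> awb_hom K (total X) (total Y)"
    by (rule awb_homI) (simp_all add: simps)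
  \<comment> \<open>Images of composable pairs are composable, which the formula for
    \<open>cmp (icat_of Y)\<close> requires.\<close>
  moreover have "bdry Y (\<alpha> (p u)) \<oplus>\<^bsub>base Y\<^esub> \<beta> (q u) = \<beta> (q v)"
    if "p u \<in> carrier (upper X)" "q u \<in> carrier (base X)"
      "bdry X (p u) \<oplus>\<^bsub>base X\<^esub> q u = q v" for u v
    using that by (simp add: bdry simps X.bdry_simps flip: that(3))
  ultimately show "icat_map X f \<in> Hom (IAWB K) (icat_of X) (icat_of Y)"
    by (simp add: f_eq icat_map_def icat_hom_def h(2,3) simps zero X.bdry_simps)
next
  fix X Y Z :: "('k, 'u) xmod" and f g
  assume "X \<in> Obj (XAWB K)" and f: "f \<in> Hom (XAWB K) X Y" and "g \<in> Hom (XAWB K) Y Z"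
  obtain \<alpha> \<beta> \<alpha>' \<beta>' where eq: "f = (\<alpha>, \<beta>)" "g = (\<alpha>', \<beta>')" by force
  note h = xmod_homD[OF f[unfolded eq XAWB_simps]]
  show "icat_map X (Comp (XAWB K) X Y Z g f)
      = Comp (IAWB K) (icat_of X) (icat_of Y) (icat_of Z) (icat_map Y g) (icat_map X f)"
    by (auto simp: eq icat_map_def compose_def awb_homD(3)[OF h(1)] awb_homD(3)[OF h(2)])
qed

end


section \<open>From internal categories to crossed modules\<close>

definition src_kernel :: "('k, 'u) icat \<Rightarrow> 'u set" where
  "src_kernel I = {b \<in> carrier (arr I). src I b = \<zero>\<^bsub>obj I\<^esub>}"

text \<open>The boundary is restricted to the kernel to be an extensional homomorphism; of the
  action only the values on the carriers matter.\<close>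

definition xmod_of :: "('k, 'u) icat \<Rightarrow> ('k, 'u) xmod" where
  "xmod_of I = \<lparr>
     upper = (arr I)\<lparr>carrier := src_kernel I\<rparr>,
     base = obj I,
     bdry = \<lambda>m \<in> src_kernel I. trg I m,
     action = \<lparr>
       lact = \<lambda>a m. idn I a \<otimes>\<^bsub>arr I\<^esub> m,
       ract = \<lambda>m a. m \<otimes>\<^bsub>arr I\<^esub> idn I a,
       lbr = \<lambda>a m. bracket (arr I) (idn I a) m,
       rbr = \<lambda>m a. bracket (arr I) m (idn I a)\<rparr>\<rparr>"

lemma xmod_of_simps [simp]:
  "upper (xmod_of I) = (arr I)\<lparr>carrier := src_kernel I\<rparr>"
  "base (xmod_of I) = obj I"
  "m \<in> src_kernel I \<Longrightarrow> bdry (xmod_of I) m = trg I m"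
  "lact (action (xmod_of I)) a m = idn I a \<otimes>\<^bsub>arr I\<^esub> m"
  "ract (action (xmod_of I)) m a = m \<otimes>\<^bsub>arr I\<^esub> idn I a"
  "lbr (action (xmod_of I)) a m = bracket (arr I) (idn I a) m"
  "rbr (action (xmod_of I)) m a = bracket (arr I) m (idn I a)"
  by (simp_all add: xmod_of_def)

definition xmod_map ::
    "('k, 'u) icat \<Rightarrow> ('u \<Rightarrow> 'u) \<times> ('u \<Rightarrow> 'u) \<Rightarrow> ('u \<Rightarrow> 'u) \<times> ('u \<Rightarrow> 'u)" where
  "xmod_map I = (\<lambda>(\<phi>, \<psi>). (restrict \<phi> (src_kernel I), \<psi>))"

context internal_category
begin

lemmas icat_simps = B.mult_simps B.bracket_simps A.mult_simps A.bracket_simps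
  src_simps trg_simps idn_simps src_zero trg_zero idn_zero src_idn trg_idn

lemma src_kernel_iff: "b \<in> src_kernel I \<longleftrightarrow> b \<in> carrier (arr I) \<and> src I b = \<zero>\<^bsub>obj I\<^esub>"
  by (simp add: src_kernel_def)

text \<open>This and the next two lemmas are the interchange laws: \<open>cmp_hom\<close> spelled
  out on composable pairs.\<close>

lemma cmp_add:
  assumes "b1 \<in> carrier (arr I)" "b2 \<in> carrier (arr I)" "trg I b1 = src I b2"
    and "c1 \<in> carrier (arr I)" "c2 \<in> carrier (arr I)" "trg I c1 = src I c2"
  shows "cmp I (b1 \<oplus>\<^bsub>arr I\<^esub> c1, b2 \<oplus>\<^bsub>arr I\<^esub> c2) = cmp I (b1, b2) \<oplus>\<^bsub>arr I\<^esub> cmp I (c1, c2)"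
  using awb_homD(4)[OF cmp_hom, of "(b1, b2)" "(c1, c2)"] assms by (simp add: awb_pullback_def)

lemma cmp_mult:
  assumes "b1 \<in> carrier (arr I)" "b2 \<in> carrier (arr I)" "trg I b1 = src I b2"
    and "c1 \<in> carrier (arr I)" "c2 \<in> carrier (arr I)" "trg I c1 = src I c2"
  shows "cmp I (b1 \<otimes>\<^bsub>arr I\<^esub> c1, b2 \<otimes>\<^bsub>arr I\<^esub> c2) = cmp I (b1, b2) \<otimes>\<^bsub>arr I\<^esub> cmp I (c1, c2)"
  using awb_homD(6)[OF cmp_hom, of "(b1, b2)" "(c1, c2)"] assms by (simp add: awb_pullback_def)

lemma cmp_bracket:
  assumes "b1 \<in> carrier (arr I)" "b2 \<in> carrier (arr I)" "trg I b1 = src I b2"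
    and "c1 \<in> carrier (arr I)" "c2 \<in> carrier (arr I)" "trg I c1 = src I c2"
  shows "cmp I (bracket (arr I) b1 c1, bracket (arr I) b2 c2)
    = bracket (arr I) (cmp I (b1, b2)) (cmp I (c1, c2))"
  using awb_homD(7)[OF cmp_hom, of "(b1, b2)" "(c1, c2)"] assms by (simp add: awb_pullback_def)

text \<open>The zero arrow is the identity of the zero object, which is the source of
  \<open>m\<close>.\<close>

lemma cmp_zero_left:
  assumes "m \<in> src_kernel I"
  shows "cmp I (\<zero>\<^bsub>arr I\<^esub>, m) = m"
  using cmp_idn_left[of m] assms by (simp add: src_kernel_iff idn_zero)

text \<open>Adding \<open>(m, idn (trg m))\<close> and \<open>(0, n)\<close> in the pullback, for \<open>n\<close> in the kernel of the source.\<close>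

lemma cmp_kernel:
  assumes "b \<in> carrier (arr I)" "n \<in> src_kernel I"
  shows "cmp I (b, idn I (trg I b) \<oplus>\<^bsub>arr I\<^esub> n) = b \<oplus>\<^bsub>arr I\<^esub> n"
  using cmp_add[of b "idn I (trg I b)" "\<zero>\<^bsub>arr I\<^esub>" n] assms
  by (simp add: src_kernel_iff icat_simps cmp_idn_right cmp_zero_left)

text \<open>
  The Peiffer identities: \<open>(m, idn (trg m))\<close> times \<open>(0, n)\<close> is \<open>(0, idn (trg m) n)\<close> in the pullback,
  and composing the two entries of each pair gives \<open>m n = idn (trg m) n\<close>.
\<close>

lemma peiffer:
  assumes "m \<in> src_kernel I" "n \<in> src_kernel I"
  shows "idn I (trg I m) \<otimes>\<^bsub>arr I\<^esub> n = m \<otimes>\<^bsub>arr I\<^esub> n"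
    and "n \<otimes>\<^bsub>arr I\<^esub> idn I (trg I m) = n \<otimes>\<^bsub>arr I\<^esub> m"
    and "bracket (arr I) (idn I (trg I m)) n = bracket (arr I) m n"
    and "bracket (arr I) n (idn I (trg I m)) = bracket (arr I) n m"
  using assms
    cmp_mult[of m "idn I (trg I m)" "\<zero>\<^bsub>arr I\<^esub>" n] cmp_mult[of "\<zero>\<^bsub>arr I\<^esub>" n m "idn I (trg I m)"]
    cmp_bracket[of m "idn I (trg I m)" "\<zero>\<^bsub>arr I\<^esub>" n]
    cmp_bracket[of "\<zero>\<^bsub>arr I\<^esub>" n m "idn I (trg I m)"]
  by (simp_all add: src_kernel_iff icat_simps cmp_idn_right cmp_zero_left)

text \<open>The action axioms are laws of the algebra of arrows with \<open>idn I a\<close> written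
  for \<open>a\<close>, and the kernel is stable because \<open>src\<close> sends a product or
  bracket with one factor in the kernel to zero. (CM1) holds because \<open>trg\<close> is a
  homomorphism with \<open>trg_idn\<close>, and (CM2) is \<open>peiffer\<close>.\<close>

lemma crossed_module_xmod_of: "crossed_module K (xmod_of I)"
proof -
  have M: "algebra_with_bracket K ((arr I)\<lparr>carrier := src_kernel I\<rparr>)"
    by (rule B.subalgebra) (auto simp: src_kernel_iff icat_simps)
  have "awb_action K (obj I) ((arr I)\<lparr>carrier := src_kernel I\<rparr>) (action (xmod_of I))"
    by (intro awb_action.intro awb_action_axioms.intro bilinear_mapI)
      (simp_all add: M A.algebra_with_bracket_axioms src_kernel_iff icat_simps B.mult_assoc
        B.bracket_mult B.M.a_comm)
  moreover have "bdry (xmod_of I) \<in> awb_hom K ((arr I)\<lparr>carrier := src_kernel I\<rparr>) (obj I)"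
    by (rule awb_homI) (auto simp: xmod_of_def src_kernel_iff icat_simps)
  ultimately show ?thesis
    by (intro crossed_module.intro crossed_module_axioms.intro)
      \<comment> \<open>The first pass settles (CM2). The second settles (CM1), where products and
        brackets with \<open>idn I a\<close> have to be recognised as kernel elements.\<close>
      (simp_all add: peiffer, simp_all add: src_kernel_iff icat_simps)
qed

end

lemma cat_functor_xmod_of:
  fixes K :: "('k, 'r) ring_scheme"
  shows "cat_functor (IAWB K) (XAWB K) xmod_of (\<lambda>I J. xmod_map I)"
proof (intro cat_functor.intro cat_functor_axioms.intro category_XAWB category_IAWB)
  fix I :: "('k, 'u) icat" assume "I \<in> Obj (IAWB K)"
  then show "xmod_of I \<in> Obj (XAWB K)"
    by (simp add: internal_category.crossed_module_xmod_of)
next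
  fix I :: "('k, 'u) icat" assume "I \<in> Obj (IAWB K)"
  show "xmod_map I (Id (IAWB K) I) = Id (XAWB K) (xmod_of I)"
    by (auto simp: xmod_map_def src_kernel_def)
next
  fix I J :: "('k, 'u) icat" and f
  assume "I \<in> Obj (IAWB K)" "J \<in> Obj (IAWB K)" and f: "f \<in> Hom (IAWB K) I J"
  then interpret I: internal_category K I + J: internal_category K J by simp_all
  obtain \<phi> \<psi> where f_eq: "f = (\<phi>, \<psi>)" by force
  note h = icat_homD[OF f[unfolded f_eq IAWB_simps]]
  note simps = awb_homD(3-7)[OF h(1)] awb_homD(3-7)[OF h(2)] h(4-5) I.icat_simps
  have zero: "\<psi> \<zero>\<^bsub>obj I\<^esub> = \<zero>\<^bsub>obj J\<^esub>"
    using h(2) I.A.algebra_with_bracket_axioms J.A.algebra_with_bracket_axioms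
    by (rule awb_hom_zero)
  have src: "src J (\<phi> b) = \<psi> (src I b)" if "b \<in> carrier (arr I)" for b
    using h(3) that by simp
  have "restrict \<phi> (src_kernel I) \<in> awb_hom K (upper (xmod_of I)) (upper (xmod_of J))"
    by (rule awb_homI) (simp_all add: I.src_kernel_iff J.src_kernel_iff simps zero src)
  then show "xmod_map I f \<in> Hom (XAWB K) (xmod_of I) (xmod_of J)"
    by (simp add: f_eq xmod_map_def xmod_hom_def h(2) I.src_kernel_iff J.src_kernel_iff
        simps zero src)
next
  fix I J L :: "('k, 'u) icat" and f g
  assume "I \<in> Obj (IAWB K)" and f: "f \<in> Hom (IAWB K) I J" and "g \<in> Hom (IAWB K) J L"
    and "J \<in> Obj (IAWB K)"
  then interpret I: internal_category K I + J: internal_category K J by simp_all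
  obtain \<phi> \<psi> \<phi>' \<psi>' where eq: "f = (\<phi>, \<psi>)" "g = (\<phi>', \<psi>')" by force
  note h = icat_homD[OF f[unfolded eq IAWB_simps]]
  have zero: "\<psi> \<zero>\<^bsub>obj I\<^esub> = \<zero>\<^bsub>obj J\<^esub>"
    using h(2) I.A.algebra_with_bracket_axioms J.A.algebra_with_bracket_axioms
    by (rule awb_hom_zero)
  \<comment> \<open>This puts \<open>\<phi> b\<close> in the domain of the restricted
    \<open>\<phi>'\<close>, so restricting the composite agrees with composing the
    restrictions.\<close>
  have "\<phi> b \<in> src_kernel J" if "b \<in> src_kernel I" for b
    using that h(3)[of b] awb_homD(3)[OF h(1)] by (simp add: I.src_kernel_iff J.src_kernel_iff zero)
  then show "xmod_map I (Comp (IAWB K) I J L g f)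
      = Comp (XAWB K) (xmod_of I) (xmod_of J) (xmod_of L) (xmod_map J g) (xmod_map I f)"
    by (auto simp: eq xmod_map_def compose_def src_kernel_def)
qed


section \<open>The equivalence\<close>

lemma (in category) cat_functor_id: "cat_functor C C (\<lambda>X. X) (\<lambda>X Y f. f)"
  by (intro cat_functor.intro cat_functor_axioms.intro category_axioms) simp_all

lemma cat_functor_comp:
  assumes "cat_functor C D Fo Fa" "cat_functor D E Go Ga"
  shows "cat_functor C E (\<lambda>X. Go (Fo X)) (\<lambda>X Y f. Ga (Fo X) (Fo Y) (Fa X Y f))"
proof -
  interpret F: cat_functor C D Fo Fa by fact
  interpret G: cat_functor D E Go Ga by fact
  show ?thesis
    by (intro cat_functor.intro cat_functor_axioms.intro F.C.category_axioms G.D.category_axioms)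
      (simp_all add: F.Fo_Obj G.Fo_Obj F.Fa_Hom G.Fa_Hom F.Fa_Id G.Fa_Id F.Fa_Comp G.Fa_Comp)
qed

context universe_pairing
begin

text \<open>The source of (m, a) is a, so the kernel of the source consists of the pairs (m, 0). On
  these the mixed terms of product and bracket vanish, which leaves a copy of M.\<close>

lemma natural_iso_unit:
  fixes K :: "('k, 'r) ring_scheme"
  shows "natural_iso (XAWB K) (XAWB K) (\<lambda>X. X) (\<lambda>X Y f. f)
    (\<lambda>X. xmod_of (icat_of X)) (\<lambda>X Y f. xmod_map (icat_of X) (icat_map X f))
    (\<lambda>X. (\<lambda>m \<in> carrier (upper X). pr m \<zero>\<^bsub>base X\<^esub>, \<lambda>a \<in> carrier (base X). a))"
proof (intro natural_iso.intro natural_iso_axioms.intro)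
  show "cat_functor (XAWB K) (XAWB K) (\<lambda>X. X) (\<lambda>X Y f. f)"
    by (rule category.cat_functor_id) (rule category_XAWB)
  show "cat_functor (XAWB K) (XAWB K) (\<lambda>X. xmod_of (icat_of X))
      (\<lambda>X Y f. xmod_map (icat_of X) (icat_map X f))"
    using cat_functor_comp[OF cat_functor_icat_of cat_functor_xmod_of] .
next
  fix X :: "('k, 'u) xmod" assume X: "X \<in> Obj (XAWB K)"
  then interpret crossed_module K X by simp
  have Y: "crossed_module K (xmod_of (icat_of X))"
    using X by (simp add: internal_category.crossed_module_xmod_of internal_category_icat_of)
  have ker: "u \<in> src_kernel (icat_of X) \<longleftrightarrow> p u \<in> carrier (upper X) \<and> q u = \<zero>\<^bsub>base X\<^esub>" for u
    by (auto simp: src_kernel_def)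
  have "(\<lambda>m \<in> carrier (upper X). pr m \<zero>\<^bsub>base X\<^esub>)
      \<in> awb_hom K (upper X) (upper (xmod_of (icat_of X)))"
    by (rule awb_homI) (simp_all add: ker bilinear_simps)
  then have hom: "(\<lambda>m \<in> carrier (upper X). pr m \<zero>\<^bsub>base X\<^esub>, \<lambda>a \<in> carrier (base X). a)
      \<in> xmod_hom K X (xmod_of (icat_of X))"
    by (simp add: xmod_hom_def awb_hom_id A.algebra_with_bracket_axioms ker bilinear_simps
        bdry_simps)
  have "bij_betw (\<lambda>m \<in> carrier (upper X). pr m \<zero>\<^bsub>base X\<^esub>) (carrier (upper X)) (src_kernel (icat_of X))"
    by (rule bij_betwI[where g = p]) (auto simp: ker intro: pr_eqI)
  then show "cat_iso (XAWB K) X (xmod_of (icat_of X))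
      (\<lambda>m \<in> carrier (upper X). pr m \<zero>\<^bsub>base X\<^esub>, \<lambda>a \<in> carrier (base X). a)"
    using X by (intro cat_iso_XAWB Y hom) (simp_all add: bij_betw_def inj_on_def)
next
  fix X Y :: "('k, 'u) xmod" and f
  assume "X \<in> Obj (XAWB K)" "Y \<in> Obj (XAWB K)" and f: "f \<in> Hom (XAWB K) X Y"
  then interpret X: crossed_module K X + Y: crossed_module K Y by simp_all
  obtain \<alpha> \<beta> where f_eq: "f = (\<alpha>, \<beta>)" by force
  note h = xmod_homD[OF f[unfolded f_eq XAWB_simps]]
  have zero: "\<beta> \<zero>\<^bsub>base X\<^esub> = \<zero>\<^bsub>base Y\<^esub>"
    using h(2) X.A.algebra_with_bracket_axioms Y.A.algebra_with_bracket_axioms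
    by (rule awb_hom_zero)
  have "\<beta> \<in> extensional (carrier (base X))"
    by (rule awb_homD(1)[OF h(2)])
  then show "Comp (XAWB K) X Y (xmod_of (icat_of Y))
      (\<lambda>m \<in> carrier (upper Y). pr m \<zero>\<^bsub>base Y\<^esub>, \<lambda>a \<in> carrier (base Y). a) f
    = Comp (XAWB K) X (xmod_of (icat_of X)) (xmod_of (icat_of Y))
      (xmod_map (icat_of X) (icat_map X f))
      (\<lambda>m \<in> carrier (upper X). pr m \<zero>\<^bsub>base X\<^esub>, \<lambda>a \<in> carrier (base X). a)"
    by (auto simp: f_eq icat_map_def xmod_map_def src_kernel_def compose_def zero
        awb_homD(3)[OF h(1)] awb_homD(3)[OF h(2)] extensional_def fun_eq_iff)
qed

text \<open>Since a acts as multiplication and bracket with \<open>idn I a\<close>, expanding (m +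
  \<sigma> a)(n + \<sigma> b) and the corresponding bracket gives exactly the semidirect formulas.
  Compatibility with composition is \<open>cmp_kernel\<close>.\<close>

lemma natural_iso_counit:
  fixes K :: "('k, 'r) ring_scheme"
  shows "natural_iso (IAWB K) (IAWB K)
    (\<lambda>I. icat_of (xmod_of I)) (\<lambda>I J f. icat_map (xmod_of I) (xmod_map I f))
    (\<lambda>I. I) (\<lambda>I J f. f)
    (\<lambda>I. (\<lambda>u \<in> carrier (total (xmod_of I)). p u \<oplus>\<^bsub>arr I\<^esub> idn I (q u), \<lambda>a \<in> carrier (obj I). a))"
proof (intro natural_iso.intro natural_iso_axioms.intro)
  show "cat_functor (IAWB K) (IAWB K) (\<lambda>I. I) (\<lambda>I J f. f)"
    by (rule category.cat_functor_id) (rule category_IAWB)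
  show "cat_functor (IAWB K) (IAWB K) (\<lambda>I. icat_of (xmod_of I))
      (\<lambda>I J f. icat_map (xmod_of I) (xmod_map I f))"
    using cat_functor_comp[OF cat_functor_xmod_of cat_functor_icat_of] .
next
  fix I :: "('k, 'u) icat" assume "I \<in> Obj (IAWB K)"
  then interpret internal_category K I by simp
  let ?e = "\<lambda>u \<in> carrier (total (xmod_of I)). p u \<oplus>\<^bsub>arr I\<^esub> idn I (q u)"
  have J: "internal_category K (icat_of (xmod_of I))"
    by (intro internal_category_icat_of crossed_module_xmod_of)
  have "?e \<in> awb_hom K (total (xmod_of I)) (arr I)"
    by (rule awb_homI) (simp_all add: src_kernel_iff icat_simps B.M.a_ac B.smult_r_distr)
  moreover have "?e (cmp (icat_of (xmod_of I)) (u, v)) = cmp I (?e u, ?e v)"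
    if uv: "u \<in> carrier (total (xmod_of I))" "v \<in> carrier (total (xmod_of I))"
      "trg (icat_of (xmod_of I)) u = src (icat_of (xmod_of I)) v" for u v
  proof -
    have car: "p u \<in> src_kernel I" "q u \<in> carrier (obj I)" "p v \<in> src_kernel I"
      and q: "q v = trg I (p u) \<oplus>\<^bsub>obj I\<^esub> q u"
      using uv by simp_all
    then show ?thesis
      \<comment> \<open>Here \<open>q v\<close> is the target of \<open>p u\<close> +
        \<open>idn I (q u)\<close>, so the second arrow \<open>idn I (q v)\<close> +
        \<open>p v\<close> has the form that \<open>cmp_kernel\<close> composes.\<close>
      using cmp_kernel[of "p u \<oplus>\<^bsub>arr I\<^esub> idn I (q u)" "p v"]
      by (simp add: src_kernel_iff icat_simps q B.M.a_ac)
  qed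
  ultimately have hom: "(?e, \<lambda>a \<in> carrier (obj I). a) \<in> icat_hom K (icat_of (xmod_of I)) I"
    by (simp add: icat_hom_def awb_hom_id A.algebra_with_bracket_axioms src_kernel_iff icat_simps)
  have diff: "(b \<oplus>\<^bsub>arr I\<^esub> c) \<ominus>\<^bsub>arr I\<^esub> c = b" "(b \<ominus>\<^bsub>arr I\<^esub> c) \<oplus>\<^bsub>arr I\<^esub> c = b"
    if "b \<in> carrier (arr I)" "c \<in> carrier (arr I)" for b c
    using that by (simp_all add: a_minus_def B.M.a_assoc B.M.r_neg B.M.l_neg)
  have src_diff: "src I (b \<ominus>\<^bsub>arr I\<^esub> idn I (src I b)) = \<zero>\<^bsub>obj I\<^esub>"
    if b: "b \<in> carrier (arr I)" for b
  proof -
    let ?i = "idn I (src I b)"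
    \<comment> \<open>Adding \<open>src I b\<close> back removes the difference, so additivity of
      \<open>src I\<close> suffices.\<close>
    have "src I (b \<ominus>\<^bsub>arr I\<^esub> ?i) \<oplus>\<^bsub>obj I\<^esub> src I b = src I ((b \<ominus>\<^bsub>arr I\<^esub> ?i) \<oplus>\<^bsub>arr I\<^esub> ?i)"
      using b by (simp add: icat_simps)
    also have "\<dots> = src I b"
      using b by (simp add: diff idn_simps src_simps)
    finally show ?thesis
      using b by (simp add: src_simps idn_simps)
  qed
  have "bij_betw ?e (carrier (total (xmod_of I))) (carrier (arr I))"
    \<comment> \<open>The inverse splits b as (b - \<sigma>(s b)) + \<sigma>(s b), whose first
      summand lies in the kernel by \<open>src_diff\<close>.\<close>
    by (rule bij_betwI[where g = "\<lambda>b. pr (b \<ominus>\<^bsub>arr I\<^esub> idn I (src I b)) (src I b)"])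
      (auto simp: src_kernel_iff icat_simps diff src_diff)
  then show "cat_iso (IAWB K) (icat_of (xmod_of I)) I (?e, \<lambda>a \<in> carrier (obj I). a)"
    by (intro cat_iso_IAWB J hom internal_category_axioms) (simp_all add: bij_betw_def inj_on_def)
next
  fix I J :: "('k, 'u) icat" and f
  assume "I \<in> Obj (IAWB K)" "J \<in> Obj (IAWB K)" and f: "f \<in> Hom (IAWB K) I J"
  then interpret I: internal_category K I + J: internal_category K J by simp_all
  obtain \<phi> \<psi> where f_eq: "f = (\<phi>, \<psi>)" by force
  note h = icat_homD[OF f[unfolded f_eq IAWB_simps]]
  have zero: "\<psi> \<zero>\<^bsub>obj I\<^esub> = \<zero>\<^bsub>obj J\<^esub>"
    using h(2) I.A.algebra_with_bracket_axioms J.A.algebra_with_bracket_axioms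
    by (rule awb_hom_zero)
  \<comment> \<open>Both sides of the naturality square send u to \<open>\<phi> (p u)\<close> +
    \<open>idn J (\<psi> (q u))\<close>; this fact places the image of u in the domain of the counit
    at \<open>J\<close>.\<close>
  have "\<phi> b \<in> src_kernel J" if "b \<in> src_kernel I" for b
    using that h(3)[of b] awb_homD(3)[OF h(1)] by (simp add: I.src_kernel_iff J.src_kernel_iff zero)
  moreover have "\<psi> \<in> extensional (carrier (obj I))"
    by (rule awb_homD(1)[OF h(2)])
  ultimately show "Comp (IAWB K) (icat_of (xmod_of I)) (icat_of (xmod_of J)) J
      (\<lambda>u \<in> carrier (total (xmod_of J)). p u \<oplus>\<^bsub>arr J\<^esub> idn J (q u), \<lambda>a \<in> carrier (obj J). a)
      (icat_map (xmod_of I) (xmod_map I f))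
    = Comp (IAWB K) (icat_of (xmod_of I)) I J f
      (\<lambda>u \<in> carrier (total (xmod_of I)). p u \<oplus>\<^bsub>arr I\<^esub> idn I (q u), \<lambda>a \<in> carrier (obj I). a)"
    by (auto simp: f_eq icat_map_def xmod_map_def I.src_kernel_iff compose_def h(5)
        awb_homD(3,4)[OF h(1)] awb_homD(3)[OF h(2)] I.icat_simps extensional_def fun_eq_iff)
qed

end

theorem theorem4p6:
  fixes K :: "('k, 'r) ring_scheme"
  assumes "field K"
    and "infinite (UNIV :: 'u set)"
  shows "equivalent_categories
    (XAWB K :: (('k, 'u) xmod, ('u \<Rightarrow> 'u) \<times> ('u \<Rightarrow> 'u)) cat)
    (IAWB K :: (('k, 'u) icat, ('u \<Rightarrow> 'u) \<times> ('u \<Rightarrow> 'u)) cat)"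
proof -
  \<comment> \<open>An infinite type is equinumerous with its square. The bijection codes pairs
    inside \<open>'u\<close>, so M \<rtimes> A again lives on a subset of the universe.\<close>
  obtain e :: "'u \<times> 'u \<Rightarrow> 'u" where "bij_betw e (UNIV \<times> UNIV) UNIV"
    using card_of_Times_same_infinite[OF assms(2)] card_of_ordIso by blast
  then have e: "bij e"
    by simp
  interpret universe_pairing "\<lambda>m a. e (m, a)" "\<lambda>u. fst (inv_into UNIV e u)" "\<lambda>u. snd (inv_into UNIV e u)"
    using e by unfold_locales (simp_all add: bij_is_inj bij_is_surj f_inv_into_f)
  show ?thesis
    unfolding equivalent_categories_def
    using category_XAWB category_IAWB cat_functor_icat_of cat_functor_xmod_of
      natural_iso_unit natural_iso_counit by blast
qed

end
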